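(* Let $n$ be a smooth, strictly positive real function on an open subset of $\mathbb{C}$, let $D\subset\mathbb{C}\setminus\{0\}$ be open, and let $z=z(\zeta)$ be a smooth complex-valued function on $D$ with values in the domain of $n$. Put $\ell(\zeta)=\log n(z(\zeta))$ and $$a=1+\zeta\,\ell_\zeta,\quad b=-\frac1\zeta\,\ell_{\bar\zeta},\quad c=\frac1{\zeta^2}\,(1-\zeta\,\ell_\zeta),\quad d=\zeta\,\ell_{\bar\zeta}.$$ Assume $|a+c|^2-|b+d|^2\neq0$ in $D$ and set $$A_{11}=2\,\frac{\mathrm{Im}\bigl[(a+b)\,\overline{(c+d)}\bigr]}{|a+c|^2-|b+d|^2},\qquad A_{12}=\frac{|a+d|^2-|b+c|^2}{|a+c|^2-|b+d|^2},$$ $$A_{21}=\frac{|a-d|^2-|b-c|^2}{|a+c|^2-|b+d|^2},\qquad A_{22}=2\,\frac{\mathrm{Im}\bigl[\overline{(a-b)}\,(c-d)\bigr]}{|a+c|^2-|b+d|^2}.$$ Suppose that in $D$ $$4\,A_{12}\,A_{21}-(A_{11}+A_{22})^2>0,\qquad A_{12}>0,$$ and that $z$ is a solution in $D$ of $$b\,z_\zeta+a\,\bar z_{\bar\zeta}-c\,z_{\bar\zeta}-d\,\bar z_\zeta=0.$$ Then, locally (in a neighborhood of each point of $D$), there exist a quasi-conformal homeomorphism $\chi=\chi(\zeta)$, an analytic function $f(\chi)$, and two complex-valued functions $\kappa(\chi)$ (with $|\kappa(\chi)|\neq1$) and $s(\chi)$ such that $$z(\zeta)=Z(\chi(\zeta)),\qquad\text{with}\qquad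 Z(\chi)=\frac{e^{s(\chi)}f(\chi)+\kappa(\chi)\,\overline{f(\chi)\,e^{s(\chi)}}}{1-|\kappa(\chi)|^2}.$$
   Context: With $\zeta=\xi+i\,\eta$: $\partial_\zeta=\frac12(\partial_\xi-i\,\partial_\eta)$, $\partial_{\bar\zeta}=\frac12(\partial_\xi+i\,\partial_\eta)$, and subscripts denote these derivatives; $\bar z_\zeta=\partial_\zeta(\bar z)$ and $\bar z_{\bar\zeta}=\partial_{\bar\zeta}(\bar z)$ are the derivatives of the conjugate function $\bar z(\zeta)=\overline{z(\zeta)}$. A quasi-conformal homeomorphism is a homeomorphism $\chi$ onto an open subset of $\mathbb{C}$ that solves a Beltrami equation $\chi_{\bar\zeta}=\sigma\,\chi_\zeta$ with $\sup|\sigma|<1$. Functions are assumed as regular as needed, and parametrizations are of local character. *)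

theory Defs
  imports "HOL-Complex_Analysis.Complex_Analysis"
begin

text \<open>
  The operators \<open>1/2 (\<partial>\<^sub>\<xi> - \<i>\<partial>\<^sub>\<eta>)\<close> and \<open>1/2 (\<partial>\<^sub>\<xi> + \<i>\<partial>\<^sub>\<eta>)\<close> for \<open>\<zeta> = \<xi> + \<i>\<eta>\<close>:
  the Frechet derivative in the directions \<open>1\<close> and \<open>\<i>\<close> is the partial derivative in
  \<open>\<xi>\<close> and \<open>\<eta>\<close>. Meaningful only where \<open>f\<close> is real-differentiable.
\<close>

definition dz :: "(complex \<Rightarrow> complex) \<Rightarrow> complex \<Rightarrow> complex" where
  "dz f \<zeta> = (frechet_derivative f (at \<zeta>) 1 - \<i> * frechet_derivative f (at \<zeta>) \<i>) / 2"

definition dzbar :: "(complex \<Rightarrow> complex) \<Rightarrow> complex \<Rightarrow> complex" where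
  "dzbar f \<zeta> = (frechet_derivative f (at \<zeta>) 1 + \<i> * frechet_derivative f (at \<zeta>) \<i>) / 2"

text \<open>\<open>C\<^sup>k\<close> and \<open>C\<^sup>\<infinity>\<close> regularity in the real sense; only used for open sets \<open>S\<close>.\<close>

primrec Ck_on :: "nat \<Rightarrow> 'a::real_normed_vector set \<Rightarrow> ('a \<Rightarrow> 'b::real_normed_vector) \<Rightarrow> bool" where
  "Ck_on 0 S f \<longleftrightarrow> continuous_on S f"
| "Ck_on (Suc k) S f \<longleftrightarrow>
     (\<forall>x\<in>S. f differentiable (at x)) \<and>
     (\<forall>v. Ck_on k S (\<lambda>x. frechet_derivative f (at x) v))"

definition smooth_on :: "'a::real_normed_vector set \<Rightarrow> ('a \<Rightarrow> 'b::real_normed_vector) \<Rightarrow> bool" where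
  "smooth_on S f \<longleftrightarrow> (\<forall>k. Ck_on k S f)"

text \<open>
  The Beltrami equation is understood in the classical sense, for a \<open>C\<^sup>1\<close> function.
  The bound \<open>k\<close> expresses \<open>sup \<bar>\<sigma>\<bar> < 1\<close> over \<open>U\<close>.
\<close>

definition quasiconformal_homeo :: "complex set \<Rightarrow> (complex \<Rightarrow> complex) \<Rightarrow> bool" where
  "quasiconformal_homeo U chi \<longleftrightarrow>
     open U \<and> open (chi ` U) \<and> (\<exists>g. homeomorphism U (chi ` U) chi g) \<and>
     Ck_on 1 U chi \<and>
     (\<exists>\<sigma> k. k < 1 \<and> (\<forall>\<zeta>\<in>U. cmod (\<sigma> \<zeta>) \<le> k \<and> dzbar chi \<zeta> = \<sigma> \<zeta> * dz chi \<zeta>))"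

end

theory Submission
  imports Defs
begin

text \<open>
  For a constant \<open>\<kappa>\<close> with \<open>cmod \<kappa> \<noteq> 1\<close> the asserted formula for \<open>Z\<close> is
  equivalent to \<open>exp s * f = z - \<kappa> * cnj z\<close>, read in the coordinate \<open>chi\<close>. So near each point
  \<open>p\<close> it is enough to find one constant \<open>\<kappa>\<close> for which \<open>F = z - \<kappa> * cnj z\<close> has such
  a factorization. How it arises depends on the behaviour of \<open>z\<close> at \<open>p\<close>.

  \<^item> If \<open>z p \<noteq> 0\<close>, then \<open>z\<close> has a continuous logarithm near \<open>p\<close>.

  \<^item> If \<open>z p = 0\<close> and the differential of \<open>z\<close> at \<open>p\<close> is not zero, then ellipticity, which
    is the discriminant condition, forbids rank one
    (\<open>elliptic_imp_Jacobian_nonzero\<close>). So \<open>z\<close> is a local diffeomorphism, and \<open>F\<close> with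
    \<open>\<kappa> = 0\<close> or \<open>\<kappa> = 2\<close> is an orientation preserving one that can be taken as the
    coordinate \<open>chi\<close>, with \<open>f w = w\<close>.

  \<^item> If \<open>z p = 0\<close> and the differential vanishes too, then \<open>l\<close> is stationary at \<open>p\<close>, hence
    \<open>a = 1\<close>, \<open>b = d = 0\<close> and \<open>c = 1 / p\<^sup>2\<close> there, and the positivity of \<open>A12\<close> becomes
    \<open>cmod (c p) < 1\<close>. With \<open>\<kappa> = p\<^sup>2\<close> the equation makes \<open>dzbar F\<close> smaller by one order
    than the first derivatives of \<open>z\<close>. If \<open>z\<close> vanishes to finite order \<open>n\<close>, the leading
    Taylor term of \<open>F\<close> is therefore a holomorphic monomial (\<open>leading_monomial\<close>), and one takes
    \<open>chi\<close> as the identity, \<open>f w = (w - p) ^ n\<close>, and \<open>s\<close> as the logarithm of the quotient.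

  \<^item> If in the last case the order is infinite, then \<open>z\<close> vanishes near \<open>p\<close>, and \<open>f = 0\<close>.

  The last claim is strong unique continuation (\<open>quasiregular_flat_imp_zero\<close>) and the analytic core.
  The conjugate \<open>u\<close> of \<open>z\<close> satisfies \<open>cmod (dzbar u) \<le> k * cmod (dz u)\<close> near \<open>p\<close> with
  some \<open>k < 1\<close>, so it is quasiregular: the square of the norm of its differential is dominated by
  its Jacobian. The Jacobian with a weight \<open>(x * g x)'\<close> at \<open>x = (cmod u)\<^sup>2\<close> is an exact form, so its
  integral over a disc is a flux through the boundary circle. In logarithmic polar coordinates
  around \<open>p\<close> this gives ordinary differential inequalities in the radius for integrals over
  circles. A doubly logarithmic weight shows that some circle is free of zeros
  unless \<open>u\<close> vanishes identically (\<open>exists_zero_free_circle\<close>). A logarithmic weight shows that a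
  zero-free circle bounds the order of vanishing at its centre
  (\<open>zero_free_circle_imp_not_flat\<close>). Together these say that a flat zero of \<open>u\<close> is an
  interior point of the zero set.
\<close>

section \<open>Calculus of smooth functions\<close>

lemma frechet_derivative_cong_open:
  assumes "open S" "x \<in> S" "\<And>y. y \<in> S \<Longrightarrow> f y = g y"
  shows "frechet_derivative f (at x) = frechet_derivative g (at x)"
proof -
  have "(f has_derivative F) (at x) \<longleftrightarrow> (g has_derivative F) (at x)" for F
    using has_derivative_transform_within_open[OF _ assms(1,2)] assms(3) by metis
  then show ?thesis unfolding frechet_derivative_def by presburger
qed

lemma Ck_on_cong:
  assumes "open S" "\<And>x. x \<in> S \<Longrightarrow> f x = g x"
  shows "Ck_on k S f \<longleftrightarrow> Ck_on k S g"
proof -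
  have "Ck_on k S f \<Longrightarrow> Ck_on k S g" if "\<And>x. x \<in> S \<Longrightarrow> f x = g x" for f g :: "'a \<Rightarrow> 'b"
    using that
  proof (induction k arbitrary: f g)
    case 0
    then show ?case by (metis Ck_on.simps(1) continuous_on_cong)
  next
    case (Suc k)
    have eq: "frechet_derivative f (at x) = frechet_derivative g (at x)" if "x \<in> S" for x
      using frechet_derivative_cong_open[OF assms(1) that] Suc.prems(2) by blast
    have "g differentiable (at x)" if "x \<in> S" for x
      using Suc.prems that has_derivative_transform_within_open[OF _ assms(1) that]
      unfolding differentiable_def by (metis Ck_on.simps(2) differentiable_def)
    moreover have "Ck_on k S (\<lambda>x. frechet_derivative g (at x) v)" for v
      using Suc.IH[of "\<lambda>x. frechet_derivative f (at x) v"] Suc.prems(1) eq by simp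
    ultimately show ?case by simp
  qed
  then show ?thesis using assms(2) by metis
qed

text \<open>
  The recursive definition of \<open>Ck_on\<close> speaks about the selected derivative
  \<open>frechet_derivative\<close>. This rule replaces it by any explicit derivative, which is how all
  closure properties below reduce to an induction on \<open>k\<close>.
\<close>
lemma Ck_on_SucI:
  assumes "open S" "\<And>x. x \<in> S \<Longrightarrow> (f has_derivative D x) (at x)" "\<And>v. Ck_on k S (\<lambda>x. D x v)"
  shows "Ck_on (Suc k) S f"
proof -
  have "Ck_on k S (\<lambda>x. frechet_derivative f (at x) v)" for v
    using Ck_on_cong[OF assms(1), of "\<lambda>x. frechet_derivative f (at x) v" "\<lambda>x. D x v"] assms(3)
      frechet_derivative_at[OF assms(2)] by metis
  then show ?thesis using assms(2) by (auto simp: differentiable_def)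
qed

lemma Ck_on_Suc_has_derivative:
  "Ck_on (Suc k) S f \<Longrightarrow> x \<in> S \<Longrightarrow> (f has_derivative frechet_derivative f (at x)) (at x)"
  by (simp add: frechet_derivative_works[symmetric])

lemma Ck_on_SucD: "Ck_on (Suc k) S f \<Longrightarrow> Ck_on k S f"
proof (induction k arbitrary: f)
  case 0
  then show ?case
    by (auto intro!: differentiable_imp_continuous_on differentiable_at_imp_differentiable_on)
next
  case (Suc k)
  then show ?case by (metis Ck_on.simps(2))
qed

lemma Ck_on_subset: "Ck_on k T f \<Longrightarrow> S \<subseteq> T \<Longrightarrow> Ck_on k S f"
proof (induction k arbitrary: f)
  case 0
  then show ?case by (simp add: continuous_on_subset)
next
  case (Suc k)
  then show ?case by (simp add: subset_iff)
qed

lemma Ck_on_const: "Ck_on k S (\<lambda>x. c)"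
proof (induction k arbitrary: c)
  case (Suc k)
  then show ?case by (simp add: frechet_derivative_const)
qed simp

lemma Ck_on_bounded_linear_compose:
  assumes "bounded_linear h" "open S"
  shows "Ck_on k S f \<Longrightarrow> Ck_on k S (\<lambda>x. h (f x))"
proof (induction k arbitrary: f)
  case 0
  then show ?case
    using assms(1) by (simp add: bounded_linear.continuous_on)
next
  case (Suc k)
  show ?case
    by (rule Ck_on_SucI[OF assms(2) bounded_linear.has_derivative[OF assms(1)
          Ck_on_Suc_has_derivative[OF Suc.prems]]])
       (use Suc in auto)
qed

lemma Ck_on_ident: "open S \<Longrightarrow> Ck_on k S (\<lambda>x. x)"
proof (cases k)
  case (Suc m)
  assume "open S"
  then show ?thesis unfolding Suc
    by (rule Ck_on_SucI[where D = "\<lambda>x v. v"]) (auto simp: Ck_on_const)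
qed simp

lemma Ck_on_add:
  assumes "open S"
  shows "Ck_on k S f \<Longrightarrow> Ck_on k S g \<Longrightarrow> Ck_on k S (\<lambda>x. f x + g x)"
proof (induction k arbitrary: f g)
  case 0
  then show ?case by (simp add: continuous_on_add)
next
  case (Suc k)
  show ?case
    by (rule Ck_on_SucI[OF assms has_derivative_add[OF
          Ck_on_Suc_has_derivative[OF Suc.prems(1)] Ck_on_Suc_has_derivative[OF Suc.prems(2)]]])
       (use Suc in auto)
qed

lemma Ck_on_bilinear:
  assumes "bounded_bilinear h" "open S"
  shows "Ck_on k S f \<Longrightarrow> Ck_on k S g \<Longrightarrow> Ck_on k S (\<lambda>x. h (f x) (g x))"
proof (induction k arbitrary: f g)
  case 0
  then show ?case using assms(1) by (simp add: bounded_bilinear.continuous_on)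
next
  case (Suc k)
  have "Ck_on k S f" "Ck_on k S g" using Suc.prems Ck_on_SucD by blast+
  with Suc show ?case
    by (intro Ck_on_SucI[OF assms(2) bounded_bilinear.FDERIV[OF assms(1)
          Ck_on_Suc_has_derivative[OF Suc.prems(1)] Ck_on_Suc_has_derivative[OF Suc.prems(2)]]]
          Ck_on_add[OF assms(2)]) auto
qed

lemma Ck_on_inverse:
  fixes f :: "'a::real_normed_vector \<Rightarrow> 'b::real_normed_field"
  assumes "open S" "\<And>x. x \<in> S \<Longrightarrow> f x \<noteq> 0"
  shows "Ck_on k S f \<Longrightarrow> Ck_on k S (\<lambda>x. inverse (f x))"
proof (induction k)
  case 0
  then show ?case using assms(2) by (simp add: continuous_on_inverse)
next
  case (Suc k)
  note IH = Suc.IH[OF Ck_on_SucD[OF Suc.prems]]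
  show ?case
  proof (rule Ck_on_SucI[OF assms(1) Deriv.has_derivative_inverse[OF assms(2)
          Ck_on_Suc_has_derivative[OF Suc.prems]]])
    fix v
    have "Ck_on k S (\<lambda>x. - (inverse (f x) * frechet_derivative f (at x) v * inverse (f x)))"
      using Suc.prems IH
      by (intro Ck_on_bounded_linear_compose[OF bounded_linear_minus[OF bounded_linear_ident] assms(1)]
          Ck_on_bilinear[OF bounded_bilinear_mult assms(1)]) auto
    then show "Ck_on k S (\<lambda>x. - (inverse (f x) * frechet_derivative f (at x) v * inverse (f x)))" .
  qed
qed

lemma Ck_on_ln:
  fixes f :: "'a::real_normed_vector \<Rightarrow> real"
  assumes "open S" "\<And>x. x \<in> S \<Longrightarrow> f x > 0"
  shows "Ck_on k S f \<Longrightarrow> Ck_on k S (\<lambda>x. ln (f x))"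
proof (cases k)
  case 0
  assume "Ck_on k S f"
  then show ?thesis using assms(2) 0 by (force intro!: continuous_on_ln)
next
  case (Suc m)
  assume f: "Ck_on k S f"
  have D: "((\<lambda>x. ln (f x)) has_derivative (\<lambda>v. inverse (f x) * frechet_derivative f (at x) v)) (at x)"
    if "x \<in> S" for x
    using has_derivative_ln[OF assms(2)[OF that] Ck_on_Suc_has_derivative[OF f[unfolded Suc] that]]
    by (simp add: field_simps)
  show ?thesis unfolding Suc
  proof (rule Ck_on_SucI[OF assms(1) D])
    show "Ck_on m S (\<lambda>x. inverse (f x) * frechet_derivative f (at x) v)" for v
      using f Ck_on_SucD[OF f[unfolded Suc]] assms(2) unfolding Suc
      by (intro Ck_on_bilinear[OF bounded_bilinear_mult assms(1)] Ck_on_inverse[OF assms(1)])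
         (auto simp: less_imp_neq[symmetric])
  qed
qed

lemma linear_complex_expand:
  assumes "linear h"
  shows "h v = Re v *\<^sub>R h 1 + Im v *\<^sub>R h \<i>"
proof -
  have "h v = h (Re v *\<^sub>R 1 + Im v *\<^sub>R \<i>)"
    by (rule arg_cong[of _ _ h]) (simp add: complex_eq_iff)
  then show ?thesis using assms by (simp add: linear_add linear_cmul)
qed

text \<open>
  The outer function has domain \<open>complex\<close>, so its derivative in an arbitrary direction is a
  real combination of the two partial derivatives. This turns the chain rule into sums and products
  of functions to which the induction hypothesis applies.
\<close>
lemma Ck_on_compose:
  fixes g :: "complex \<Rightarrow> 'b::real_normed_vector" and f :: "'a::real_normed_vector \<Rightarrow> complex"
  assumes "open S" "f ` S \<subseteq> T"
  shows "Ck_on k T g \<Longrightarrow> Ck_on k S f \<Longrightarrow> Ck_on k S (\<lambda>x. g (f x))"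
proof (induction k arbitrary: g)
  case 0
  then show ?case using assms(2) by (auto intro: continuous_on_compose2)
next
  case (Suc k)
  let ?g = "\<lambda>v y. frechet_derivative g (at y) v" and ?f = "\<lambda>v x. frechet_derivative f (at x) v"
  have D: "((\<lambda>x. g (f x)) has_derivative (\<lambda>v. Re (?f v x) *\<^sub>R ?g 1 (f x) + Im (?f v x) *\<^sub>R ?g \<i> (f x))) (at x)"
    if x: "x \<in> S" for x
  proof -
    have g': "(g has_derivative frechet_derivative g (at (f x))) (at (f x))"
      using Ck_on_Suc_has_derivative[OF Suc.prems(1)] assms(2) x by auto
    have "((\<lambda>x. g (f x)) has_derivative (\<lambda>v. frechet_derivative g (at (f x)) (?f v x))) (at x)"
      using has_derivative_compose[OF Ck_on_Suc_has_derivative[OF Suc.prems(2) x] g'] .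
    then show ?thesis
      by (rule has_derivative_eq_rhs)
         (rule ext, rule linear_complex_expand[OF has_derivative_linear[OF g']])
  qed
  have "Ck_on k S (\<lambda>x. ?g w (f x))" for w
    using Suc.IH[of "?g w"] Suc.prems Ck_on_SucD[OF Suc.prems(2)] by simp
  moreover have "Ck_on k S (\<lambda>x. Re (?f v x))" "Ck_on k S (\<lambda>x. Im (?f v x))" for v
    using Suc.prems(2)
    by (auto intro: Ck_on_bounded_linear_compose[OF bounded_linear_Re assms(1)]
        Ck_on_bounded_linear_compose[OF bounded_linear_Im assms(1)])
  ultimately show ?case
    by (intro Ck_on_SucI[OF assms(1) D] Ck_on_add[OF assms(1)]
        Ck_on_bilinear[OF bounded_bilinear_scaleR assms(1)]) auto
qed

lemma Ck_on_exp: "Ck_on k UNIV (exp :: complex \<Rightarrow> complex)"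
proof (induction k)
  case 0
  then show ?case by (simp add: continuous_on_exp)
next
  case (Suc k)
  show ?case
  proof (rule Ck_on_SucI)
    show "(exp has_derivative (\<lambda>v. exp x * v)) (at x)" for x :: complex
      using DERIV_exp[of x] by (simp add: has_field_derivative_def)
    show "Ck_on k UNIV (\<lambda>x. exp x * v)" for v :: complex
      by (rule Ck_on_bounded_linear_compose[OF bounded_linear_mult_left open_UNIV Suc])
  qed simp
qed

lemma smooth_on_has_derivative:
  "smooth_on S f \<Longrightarrow> x \<in> S \<Longrightarrow> (f has_derivative frechet_derivative f (at x)) (at x)"
  unfolding smooth_on_def by (meson Ck_on_Suc_has_derivative)

lemma smooth_on_differentiable: "smooth_on S f \<Longrightarrow> x \<in> S \<Longrightarrow> f differentiable (at x)"
  using smooth_on_has_derivative differentiableI by blast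

lemma smooth_on_continuous: "smooth_on S f \<Longrightarrow> continuous_on S f"
  unfolding smooth_on_def by (metis Ck_on.simps(1))

lemma smooth_on_frechet_derivative: "smooth_on S f \<Longrightarrow> smooth_on S (\<lambda>x. frechet_derivative f (at x) v)"
  unfolding smooth_on_def by (metis Ck_on.simps(2))

lemma smooth_on_subset: "smooth_on T f \<Longrightarrow> S \<subseteq> T \<Longrightarrow> smooth_on S f"
  unfolding smooth_on_def by (blast intro: Ck_on_subset)

lemma smooth_on_cong:
  "open S \<Longrightarrow> (\<And>x. x \<in> S \<Longrightarrow> f x = g x) \<Longrightarrow> smooth_on S f \<longleftrightarrow> smooth_on S g"
  unfolding smooth_on_def using Ck_on_cong by blast

lemma smooth_on_const: "smooth_on S (\<lambda>x. c)"
  by (simp add: smooth_on_def Ck_on_const)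

lemma smooth_on_ident: "open S \<Longrightarrow> smooth_on S (\<lambda>x. x)"
  by (simp add: smooth_on_def Ck_on_ident)

lemma smooth_on_bounded_linear_compose:
  "open S \<Longrightarrow> bounded_linear h \<Longrightarrow> smooth_on S f \<Longrightarrow> smooth_on S (\<lambda>x. h (f x))"
  by (simp add: smooth_on_def Ck_on_bounded_linear_compose)

lemma smooth_on_add:
  "open S \<Longrightarrow> smooth_on S f \<Longrightarrow> smooth_on S g \<Longrightarrow> smooth_on S (\<lambda>x. f x + g x)"
  by (simp add: smooth_on_def Ck_on_add)

lemma smooth_on_minus: "open S \<Longrightarrow> smooth_on S f \<Longrightarrow> smooth_on S (\<lambda>x. - f x)"
  by (rule smooth_on_bounded_linear_compose[OF _ bounded_linear_minus[OF bounded_linear_ident]])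

lemma smooth_on_diff:
  "open S \<Longrightarrow> smooth_on S f \<Longrightarrow> smooth_on S g \<Longrightarrow> smooth_on S (\<lambda>x. f x - g x)"
  using smooth_on_add[of S f "\<lambda>x. - g x"] smooth_on_minus[of S g] by simp

lemma smooth_on_mult:
  fixes f g :: "'a::real_normed_vector \<Rightarrow> 'b::real_normed_algebra"
  shows "open S \<Longrightarrow> smooth_on S f \<Longrightarrow> smooth_on S g \<Longrightarrow> smooth_on S (\<lambda>x. f x * g x)"
  by (simp add: smooth_on_def Ck_on_bilinear[OF bounded_bilinear_mult])

lemma smooth_on_power:
  fixes f :: "'a::real_normed_vector \<Rightarrow> 'b::real_normed_field"
  shows "open S \<Longrightarrow> smooth_on S f \<Longrightarrow> smooth_on S (\<lambda>x. f x ^ n)"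
  by (induction n) (auto simp: smooth_on_const intro: smooth_on_mult)

lemma smooth_on_inverse:
  fixes f :: "'a::real_normed_vector \<Rightarrow> 'b::real_normed_field"
  shows "open S \<Longrightarrow> smooth_on S f \<Longrightarrow> (\<And>x. x \<in> S \<Longrightarrow> f x \<noteq> 0) \<Longrightarrow> smooth_on S (\<lambda>x. inverse (f x))"
  by (simp add: smooth_on_def Ck_on_inverse)

lemma smooth_on_divide:
  fixes f g :: "'a::real_normed_vector \<Rightarrow> 'b::real_normed_field"
  shows "open S \<Longrightarrow> smooth_on S f \<Longrightarrow> smooth_on S g \<Longrightarrow> (\<And>x. x \<in> S \<Longrightarrow> g x \<noteq> 0) \<Longrightarrow>
    smooth_on S (\<lambda>x. f x / g x)"
  unfolding divide_inverse by (simp add: smooth_on_mult smooth_on_inverse)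

lemma smooth_on_ln:
  fixes f :: "'a::real_normed_vector \<Rightarrow> real"
  shows "open S \<Longrightarrow> smooth_on S f \<Longrightarrow> (\<And>x. x \<in> S \<Longrightarrow> f x > 0) \<Longrightarrow> smooth_on S (\<lambda>x. ln (f x))"
  by (simp add: smooth_on_def Ck_on_ln)

lemma smooth_on_compose:
  fixes g :: "complex \<Rightarrow> 'b::real_normed_vector" and f :: "'a::real_normed_vector \<Rightarrow> complex"
  shows "open S \<Longrightarrow> smooth_on T g \<Longrightarrow> smooth_on S f \<Longrightarrow> f ` S \<subseteq> T \<Longrightarrow> smooth_on S (\<lambda>x. g (f x))"
  by (simp add: smooth_on_def Ck_on_compose)

lemma smooth_on_exp: "smooth_on UNIV (exp :: complex \<Rightarrow> complex)"
  by (simp add: smooth_on_def Ck_on_exp)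

lemma smooth_on_cnj: "open S \<Longrightarrow> smooth_on S f \<Longrightarrow> smooth_on S (\<lambda>x. cnj (f x))"
  by (rule smooth_on_bounded_linear_compose[OF _ bounded_linear_cnj])

lemma smooth_on_of_real:
  fixes f :: "'a::real_normed_vector \<Rightarrow> real"
  shows "open S \<Longrightarrow> smooth_on S f \<Longrightarrow> smooth_on S (\<lambda>x. complex_of_real (f x))"
  by (rule smooth_on_bounded_linear_compose[OF _ bounded_linear_of_real])

lemmas smooth_on_intros = smooth_on_const smooth_on_ident smooth_on_add smooth_on_minus
  smooth_on_diff smooth_on_mult smooth_on_power smooth_on_inverse smooth_on_divide smooth_on_cnj
  smooth_on_of_real

section \<open>Symmetry of second derivatives\<close>

text \<open>
  Schwarz' theorem. By the fundamental theorem of calculus an increment of \<open>f\<close> in direction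
  \<open>w\<close> is the integral of the derivative in direction \<open>w\<close>. Differentiating this under the
  integral sign in direction \<open>v\<close>, and then in the upper limit of integration, interchanges the
  order of the two derivatives.
\<close>
lemma smooth_on_frechet_derivative_commute:
  fixes f :: "'a::real_normed_vector \<Rightarrow> 'b::banach"
  assumes S: "open S" "x \<in> S" and f: "smooth_on S f"
  shows "frechet_derivative (\<lambda>y. frechet_derivative f (at y) v) (at x) w
       = frechet_derivative (\<lambda>y. frechet_derivative f (at y) w) (at x) v"
proof -
  let ?D = "\<lambda>g v y. frechet_derivative g (at y) v"
  define \<gamma> where "\<gamma> r s = x + r *\<^sub>R v + s *\<^sub>R w" for r s :: real
  obtain e where e: "e > 0" "ball x e \<subseteq> S" using S open_contains_ball by blast
  define \<delta> where "\<delta> = e / (2 * (norm v + norm w + 1))"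
  have \<delta>: "\<delta> > 0" using e by (simp add: \<delta>_def add_nonneg_pos)
  have in_S: "\<gamma> r s \<in> S" if "\<bar>r\<bar> \<le> \<delta>" "\<bar>s\<bar> \<le> \<delta>" for r s
  proof -
    have "norm (r *\<^sub>R v + s *\<^sub>R w) \<le> \<bar>r\<bar> * norm v + \<bar>s\<bar> * norm w"
      by (metis norm_scaleR norm_triangle_ineq)
    also have "\<dots> \<le> \<delta> * norm v + \<delta> * norm w"
      using that by (intro add_mono mult_right_mono) auto
    also have "\<dots> < \<delta> * (2 * (norm v + norm w + 1))"
    proof -
      have "0 \<le> \<delta> * norm v" "0 \<le> \<delta> * norm w" using \<delta> by simp_all
      moreover have "\<delta> * (2 * (norm v + norm w + 1)) = 2 * (\<delta> * norm v) + 2 * (\<delta> * norm w) + 2 * \<delta>"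
        by (simp add: algebra_simps)
      ultimately show ?thesis using \<delta> by linarith
    qed
    also have "\<dots> = e" by (simp add: \<delta>_def) (smt (verit) norm_ge_zero)
    finally show ?thesis using e(2) unfolding \<gamma>_def
      by (auto simp: dist_norm algebra_simps norm_minus_commute subset_iff)
  qed
  have \<gamma>r: "((\<lambda>r. \<gamma> r s) has_vector_derivative v) (at r within A)"
    and \<gamma>s: "((\<lambda>s. \<gamma> r s) has_vector_derivative w) (at s within A)" for r s A
    unfolding \<gamma>_def by (auto intro!: derivative_eq_intros simp: has_vector_derivative_def)
  have chain_r: "((\<lambda>r. g (\<gamma> r s)) has_vector_derivative ?D g v (\<gamma> r s)) (at r within A)"
    and chain_s: "((\<lambda>s. g (\<gamma> r s)) has_vector_derivative ?D g w (\<gamma> r s)) (at s within A)"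
    if "\<bar>r\<bar> \<le> \<delta>" "\<bar>s\<bar> \<le> \<delta>" "smooth_on S g" for r s A and g :: "'a \<Rightarrow> 'b"
    using vector_derivative_diff_chain_within[OF \<gamma>r, of g "frechet_derivative g (at (\<gamma> r s))" r s A]
      vector_derivative_diff_chain_within[OF \<gamma>s, of g "frechet_derivative g (at (\<gamma> r s))" r s A]
      has_derivative_at_withinI[OF smooth_on_has_derivative[OF that(3) in_S[OF that(1,2)]]]
    by (auto simp: o_def)
  note smooth = smooth_on_frechet_derivative[OF f] smooth_on_frechet_derivative[OF smooth_on_frechet_derivative[OF f]]
  let ?I = "{-\<delta>..\<delta>}"
  have \<gamma>_cont: "continuous_on A (\<lambda>x. \<gamma> (fst x) (snd x))" for A
    unfolding \<gamma>_def by (intro continuous_intros)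
  have cont: "continuous_on (?I \<times> ?I) (\<lambda>(r, s). g (\<gamma> r s))" if "smooth_on S g" for g :: "'a \<Rightarrow> 'b"
    unfolding case_prod_unfold
    by (rule continuous_on_compose2[OF smooth_on_continuous[OF that] \<gamma>_cont]) (auto intro!: in_S)
  have cont1: "continuous_on ?I (\<lambda>s. g (\<gamma> r s))" if "smooth_on S g" "r \<in> ?I" for r and g :: "'a \<Rightarrow> 'b"
    by (rule continuous_on_compose2[OF smooth_on_continuous[OF that(1)], of _ "\<lambda>s. \<gamma> r s"])
       (use that in_S[of r] in \<open>auto intro!: continuous_intros simp: \<gamma>_def\<close>)
  \<comment> \<open>the increment formula in direction \<open>w\<close>, differentiated in direction \<open>v\<close> at \<open>r = 0\<close>\<close>
  have key: "?D f v (\<gamma> 0 s) - ?D f v (\<gamma> 0 (-\<delta>)) = integral {-\<delta>..s} (\<lambda>s. ?D (?D f w) v (\<gamma> 0 s))"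
    if s: "s \<in> ?I" for s
  proof -
    have sub: "{-\<delta>..s} \<subseteq> ?I" using s by auto
    have lhs: "((\<lambda>r. integral (cbox (-\<delta>) s) (\<lambda>s. ?D f w (\<gamma> r s))) has_vector_derivative
        integral (cbox (-\<delta>) s) (\<lambda>s. ?D (?D f w) v (\<gamma> 0 s))) (at 0 within ?I)"
    proof (rule leibniz_rule_vector_derivative)
      show "((\<lambda>r. ?D f w (\<gamma> r t)) has_vector_derivative ?D (?D f w) v (\<gamma> r t)) (at r within ?I)"
        if "r \<in> ?I" "t \<in> cbox (-\<delta>) s" for r t
        using that s by (intro chain_r smooth) auto
      show "(\<lambda>s. ?D f w (\<gamma> r s)) integrable_on cbox (-\<delta>) s" if "r \<in> ?I" for r
        using continuous_on_subset[OF cont1[OF smooth(1) that] sub] by (simp add: integrable_continuous_interval)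
      show "continuous_on (?I \<times> cbox (-\<delta>) s) (\<lambda>(r, t). ?D (?D f w) v (\<gamma> r t))"
        by (rule continuous_on_subset[OF cont[OF smooth(2)]]) (use s in auto)
    qed (use \<delta> in auto)
    have ftc: "integral {-\<delta>..s} (\<lambda>s. ?D f w (\<gamma> r s)) = f (\<gamma> r s) - f (\<gamma> r (-\<delta>))" if "r \<in> ?I" for r
    proof (rule integral_unique, rule fundamental_theorem_of_calculus)
      show "((\<lambda>s. f (\<gamma> r s)) has_vector_derivative ?D f w (\<gamma> r t)) (at t within {-\<delta>..s})"
        if "t \<in> {-\<delta>..s}" for t
        using \<open>r \<in> ?I\<close> that s by (intro chain_s[OF _ _ f]) auto
    qed (use s in auto)
    have "((\<lambda>r. integral (cbox (-\<delta>) s) (\<lambda>s. ?D f w (\<gamma> r s))) has_vector_derivative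
        ?D f v (\<gamma> 0 s) - ?D f v (\<gamma> 0 (-\<delta>))) (at 0 within ?I)"
    proof (rule has_vector_derivative_transform[of 0 ?I _ "\<lambda>r. f (\<gamma> r s) - f (\<gamma> r (-\<delta>))"])
      show "((\<lambda>r. f (\<gamma> r s) - f (\<gamma> r (-\<delta>))) has_vector_derivative
          ?D f v (\<gamma> 0 s) - ?D f v (\<gamma> 0 (-\<delta>))) (at 0 within ?I)"
        using s \<delta> by (intro has_vector_derivative_diff chain_r f) auto
    qed (use \<delta> ftc in auto)
    from vector_derivative_unique_within[OF _ this lhs]
    show ?thesis using \<delta> by (simp add: trivial_limit_within islimpt_Icc)
  qed
  have "((\<lambda>s. integral {-\<delta>..s} (\<lambda>s. ?D (?D f w) v (\<gamma> 0 s))) has_vector_derivative ?D (?D f w) v (\<gamma> 0 0)) (at 0 within ?I)"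
    using integral_has_vector_derivative[OF cont1[OF smooth(2), of 0], of 0] \<delta> by auto
  then have "((\<lambda>s. ?D f v (\<gamma> 0 s) - ?D f v (\<gamma> 0 (-\<delta>))) has_vector_derivative ?D (?D f w) v (\<gamma> 0 0)) (at 0 within ?I)"
    by (rule has_vector_derivative_transform[rotated 2]) (use \<delta> key in auto)
  moreover have "((\<lambda>s. ?D f v (\<gamma> 0 s) - ?D f v (\<gamma> 0 (-\<delta>))) has_vector_derivative ?D (?D f v) w (\<gamma> 0 0)) (at 0 within ?I)"
    using chain_s[OF _ _ smooth(1), of 0 0] \<delta> by (auto intro!: derivative_eq_intros)
  ultimately have "?D (?D f w) v (\<gamma> 0 0) = ?D (?D f v) w (\<gamma> 0 0)"
    using \<delta> by (intro vector_derivative_unique_within[of 0 ?I]) (auto simp: trivial_limit_within islimpt_Icc)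
  then show ?thesis by (simp add: \<gamma>_def)
qed

section \<open>Wirtinger derivatives\<close>

lemma has_derivative_Wirtinger:
  assumes "f differentiable (at x)"
  shows "(f has_derivative (\<lambda>v. dz f x * v + dzbar f x * cnj v)) (at x)"
proof -
  let ?D = "frechet_derivative f (at x)"
  have D: "(f has_derivative ?D) (at x)" using assms frechet_derivative_works by blast
  have "?D v = dz f x * v + dzbar f x * cnj v" for v
  proof -
    have "?D v = Re v *\<^sub>R ?D 1 + Im v *\<^sub>R ?D \<i>"
      by (rule linear_complex_expand[OF has_derivative_linear[OF D]])
    then show ?thesis by (simp add: dz_def dzbar_def complex_eq_iff field_simps)
  qed
  then show ?thesis by (intro has_derivative_eq_rhs[OF D] ext)
qed

lemma Wirtinger_eqI:
  assumes "(f has_derivative (\<lambda>v. A * v + B * cnj v)) (at x)"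
  shows "dz f x = A" "dzbar f x = B"
  using frechet_derivative_at[OF assms, symmetric]
  by (simp_all add: dz_def dzbar_def algebra_simps)

lemma
  assumes "open S" "smooth_on S f"
  shows smooth_on_dz: "smooth_on S (dz f)" and smooth_on_dzbar: "smooth_on S (dzbar f)"
proof -
  note D = smooth_on_frechet_derivative[OF assms(2)]
  have "smooth_on S (\<lambda>x. (frechet_derivative f (at x) 1 - \<i> * frechet_derivative f (at x) \<i>) / 2)"
    by (rule smooth_on_divide[OF assms(1) smooth_on_diff[OF assms(1) D
            smooth_on_mult[OF assms(1) smooth_on_const D]] smooth_on_const]) simp
  then show "smooth_on S (dz f)" by (simp only: dz_def[abs_def])
  have "smooth_on S (\<lambda>x. (frechet_derivative f (at x) 1 + \<i> * frechet_derivative f (at x) \<i>) / 2)"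
    by (rule smooth_on_divide[OF assms(1) smooth_on_add[OF assms(1) D
            smooth_on_mult[OF assms(1) smooth_on_const D]] smooth_on_const]) simp
  then show "smooth_on S (dzbar f)" by (simp only: dzbar_def[abs_def])
qed

lemma Wirtinger_cong_open:
  assumes "open S" "x \<in> S" "\<And>y. y \<in> S \<Longrightarrow> f y = g y"
  shows "dz f x = dz g x" "dzbar f x = dzbar g x"
  by (simp_all add: dz_def dzbar_def frechet_derivative_cong_open[OF assms])

lemma Wirtinger_minus_cnj:
  assumes "f differentiable (at x)"
  shows "dz (\<lambda>x. f x - \<kappa> * cnj (f x)) x = dz f x - \<kappa> * cnj (dzbar f x)"
    "dzbar (\<lambda>x. f x - \<kappa> * cnj (f x)) x = dzbar f x - \<kappa> * cnj (dz f x)"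
proof -
  note D = has_derivative_Wirtinger[OF assms]
  have "((\<lambda>x. f x - \<kappa> * cnj (f x)) has_derivative
      (\<lambda>v. (dz f x - \<kappa> * cnj (dzbar f x)) * v + (dzbar f x - \<kappa> * cnj (dz f x)) * cnj v)) (at x)"
    by (rule has_derivative_eq_rhs,
        rule has_derivative_diff[OF D has_derivative_mult_right[OF has_derivative_cnj[OF D]]])
       (simp add: algebra_simps)
  from Wirtinger_eqI[OF this]
  show "dz (\<lambda>x. f x - \<kappa> * cnj (f x)) x = dz f x - \<kappa> * cnj (dzbar f x)"
    "dzbar (\<lambda>x. f x - \<kappa> * cnj (f x)) x = dzbar f x - \<kappa> * cnj (dz f x)" .
qed

lemma Wirtinger_add:
  assumes "f differentiable (at x)" "g differentiable (at x)"
  shows "dz (\<lambda>x. f x + g x) x = dz f x + dz g x" "dzbar (\<lambda>x. f x + g x) x = dzbar f x + dzbar g x"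
proof -
  have "((\<lambda>x. f x + g x) has_derivative (\<lambda>v. (dz f x + dz g x) * v + (dzbar f x + dzbar g x) * cnj v)) (at x)"
    by (rule has_derivative_eq_rhs, rule has_derivative_add[OF assms[THEN has_derivative_Wirtinger]])
       (simp add: algebra_simps)
  from Wirtinger_eqI[OF this]
  show "dz (\<lambda>x. f x + g x) x = dz f x + dz g x" "dzbar (\<lambda>x. f x + g x) x = dzbar f x + dzbar g x" .
qed

lemma Wirtinger_mult:
  assumes "f differentiable (at x)" "g differentiable (at x)"
  shows "dz (\<lambda>x. f x * g x) x = dz f x * g x + f x * dz g x"
    "dzbar (\<lambda>x. f x * g x) x = dzbar f x * g x + f x * dzbar g x"
proof -
  have "((\<lambda>x. f x * g x) has_derivative
      (\<lambda>v. (dz f x * g x + f x * dz g x) * v + (dzbar f x * g x + f x * dzbar g x) * cnj v)) (at x)"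
    by (rule has_derivative_eq_rhs, rule has_derivative_mult[OF assms[THEN has_derivative_Wirtinger]])
       (simp add: algebra_simps)
  from Wirtinger_eqI[OF this]
  show "dz (\<lambda>x. f x * g x) x = dz f x * g x + f x * dz g x"
    "dzbar (\<lambda>x. f x * g x) x = dzbar f x * g x + f x * dzbar g x" .
qed

lemma Wirtinger_cnj:
  assumes "f differentiable (at x)"
  shows "dz (\<lambda>x. cnj (f x)) x = cnj (dzbar f x)" "dzbar (\<lambda>x. cnj (f x)) x = cnj (dz f x)"
proof -
  have "((\<lambda>x. cnj (f x)) has_derivative (\<lambda>v. cnj (dzbar f x) * v + cnj (dz f x) * cnj v)) (at x)"
    by (rule has_derivative_eq_rhs, rule has_derivative_cnj[OF assms[THEN has_derivative_Wirtinger]])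
       (simp add: algebra_simps)
  from Wirtinger_eqI[OF this]
  show "dz (\<lambda>x. cnj (f x)) x = cnj (dzbar f x)" "dzbar (\<lambda>x. cnj (f x)) x = cnj (dz f x)" .
qed

lemma Wirtinger_holomorphic:
  assumes "(f has_field_derivative f') (at x)"
  shows "dz f x = f'" "dzbar f x = 0"
proof -
  have "(f has_derivative (\<lambda>v. f' * v + 0 * cnj v)) (at x)"
    using assms by (simp add: has_field_derivative_def)
  from Wirtinger_eqI[OF this] show "dz f x = f'" "dzbar f x = 0" .
qed

lemma dz_dzbar_commute:
  assumes "open S" "x \<in> S" "smooth_on S f"
  shows "dz (dzbar f) x = dzbar (dz f) x"
proof -
  let ?D = "\<lambda>v y. frechet_derivative f (at y) v"
  have D: "(?D v has_derivative frechet_derivative (?D v) (at x)) (at x)" for v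
    using smooth_on_has_derivative[OF smooth_on_frechet_derivative[OF assms(3)] assms(2)] .
  have 1: "frechet_derivative (dz f) (at x) = (\<lambda>w. (frechet_derivative (?D 1) (at x) w - \<i> * frechet_derivative (?D \<i>) (at x) w) / 2)"
    unfolding dz_def[abs_def]
    by (rule frechet_derivative_at[symmetric], rule bounded_linear.has_derivative[OF bounded_linear_divide],
        rule has_derivative_diff[OF D has_derivative_mult_right[OF D]])
  have 2: "frechet_derivative (dzbar f) (at x) = (\<lambda>w. (frechet_derivative (?D 1) (at x) w + \<i> * frechet_derivative (?D \<i>) (at x) w) / 2)"
    unfolding dzbar_def[abs_def]
    by (rule frechet_derivative_at[symmetric], rule bounded_linear.has_derivative[OF bounded_linear_divide],
        rule has_derivative_add[OF D has_derivative_mult_right[OF D]])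
  show ?thesis
    unfolding dz_def[of "dzbar f"] dzbar_def[of "dz f"] 1 2
    using smooth_on_frechet_derivative_commute[OF assms, of 1 \<i>] by (simp add: field_simps)
qed

section \<open>Order of vanishing\<close>

text \<open>
  All iterated \<open>dz\<close>- and \<open>dzbar\<close>-derivatives of order less than \<open>n\<close> vanish at
  \<open>p\<close>. For smooth \<open>f\<close> this means that the Taylor polynomial of degree \<open>n - 1\<close> is zero. The
  Wirtinger operators are used as the basis of the derivatives because they make the Taylor
  polynomial of a solution of a \<open>dzbar\<close>-equation visible.
\<close>
primrec vanishes_to_order :: "nat \<Rightarrow> complex \<Rightarrow> (complex \<Rightarrow> complex) \<Rightarrow> bool" where
  "vanishes_to_order 0 p f \<longleftrightarrow> True"
| "vanishes_to_order (Suc n) p f \<longleftrightarrow>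
     f p = 0 \<and> vanishes_to_order n p (dz f) \<and> vanishes_to_order n p (dzbar f)"

lemma vanishes_to_order_cong:
  assumes "open S" "p \<in> S" "\<And>x. x \<in> S \<Longrightarrow> f x = g x"
  shows "vanishes_to_order n p f \<longleftrightarrow> vanishes_to_order n p g"
  using assms(3)
proof (induction n arbitrary: f g)
  case (Suc n)
  have "dz f x = dz g x" "dzbar f x = dzbar g x" if "x \<in> S" for x
    using Wirtinger_cong_open[OF assms(1) that] Suc.prems by blast+
  then show ?case
    using Suc.IH[of "dz f" "dz g"] Suc.IH[of "dzbar f" "dzbar g"] Suc.prems[OF assms(2)] by simp
qed simp

lemma vanishes_to_order_SucD: "vanishes_to_order (Suc n) p f \<Longrightarrow> vanishes_to_order n p f"
proof (induction n arbitrary: f)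
  case (Suc n)
  then show ?case by (metis vanishes_to_order.simps(2))
qed simp

context
  fixes S :: "complex set" and p :: complex
  assumes S: "open S" "p \<in> S"
begin

lemma vanishes_to_order_add:
  "smooth_on S f \<Longrightarrow> smooth_on S g \<Longrightarrow> vanishes_to_order n p f \<Longrightarrow> vanishes_to_order n p g \<Longrightarrow>
    vanishes_to_order n p (\<lambda>x. f x + g x)"
proof (induction n arbitrary: f g)
  case (Suc n)
  have d: "f differentiable (at x)" "g differentiable (at x)" if "x \<in> S" for x
    using Suc.prems(1,2) smooth_on_differentiable that by blast+
  have "vanishes_to_order n p (dz (\<lambda>x. f x + g x))"
    using Suc.prems Suc.IH[of "dz f" "dz g"] Wirtinger_add(1)[OF d]
    by (subst vanishes_to_order_cong[OF S, of _ "\<lambda>x. dz f x + dz g x"]) (auto intro: smooth_on_dz S)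
  moreover have "vanishes_to_order n p (dzbar (\<lambda>x. f x + g x))"
    using Suc.prems Suc.IH[of "dzbar f" "dzbar g"] Wirtinger_add(2)[OF d]
    by (subst vanishes_to_order_cong[OF S, of _ "\<lambda>x. dzbar f x + dzbar g x"]) (auto intro: smooth_on_dzbar S)
  ultimately show ?case using Suc.prems by simp
qed simp

lemma vanishes_to_order_mult_smooth:
  "smooth_on S f \<Longrightarrow> smooth_on S g \<Longrightarrow> vanishes_to_order n p g \<Longrightarrow> vanishes_to_order n p (\<lambda>x. f x * g x)"
proof (induction n arbitrary: f g)
  case (Suc n)
  have d: "f differentiable (at x)" "g differentiable (at x)" if "x \<in> S" for x
    using Suc.prems(1,2) smooth_on_differentiable that by blast+
  note sm = Suc.prems(1,2) smooth_on_dz[OF S(1)] smooth_on_dzbar[OF S(1)] smooth_on_mult[OF S(1)]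
  have "vanishes_to_order n p (\<lambda>x. dz f x * g x + f x * dz g x)"
    using Suc.prems(3) vanishes_to_order_SucD[OF Suc.prems(3)]
    by (intro vanishes_to_order_add Suc.IH sm) auto
  then have "vanishes_to_order n p (dz (\<lambda>x. f x * g x))"
    by (subst vanishes_to_order_cong[OF S]) (use Wirtinger_mult(1)[OF d] in auto)
  moreover have "vanishes_to_order n p (\<lambda>x. dzbar f x * g x + f x * dzbar g x)"
    using Suc.prems(3) vanishes_to_order_SucD[OF Suc.prems(3)]
    by (intro vanishes_to_order_add Suc.IH sm) auto
  then have "vanishes_to_order n p (dzbar (\<lambda>x. f x * g x))"
    by (subst vanishes_to_order_cong[OF S]) (use Wirtinger_mult(2)[OF d] in auto)
  ultimately show ?case using Suc.prems by simp
qed simp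

text \<open>
  The gain of one order is the reason why a first order equation with variable coefficients acts
  on leading Taylor terms like the equation with the coefficients frozen at \<open>p\<close>.
\<close>
lemma vanishes_to_order_Suc_mult:
  "smooth_on S f \<Longrightarrow> smooth_on S g \<Longrightarrow> f p = 0 \<Longrightarrow> vanishes_to_order n p g \<Longrightarrow>
    vanishes_to_order (Suc n) p (\<lambda>x. f x * g x)"
proof (induction n arbitrary: f g)
  case 0
  then show ?case by simp
next
  case (Suc n)
  have d: "f differentiable (at x)" "g differentiable (at x)" if "x \<in> S" for x
    using Suc.prems(1,2) smooth_on_differentiable that by blast+
  note sm = Suc.prems(1,2) smooth_on_dz[OF S(1)] smooth_on_dzbar[OF S(1)] smooth_on_mult[OF S(1)]
  have "vanishes_to_order (Suc n) p (\<lambda>x. dz f x * g x + f x * dz g x)"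
    using Suc.prems
    by (intro vanishes_to_order_add vanishes_to_order_mult_smooth[OF _ _ Suc.prems(4)] Suc.IH sm) auto
  then have "vanishes_to_order (Suc n) p (dz (\<lambda>x. f x * g x))"
    by (subst vanishes_to_order_cong[OF S]) (use Wirtinger_mult(1)[OF d] in auto)
  moreover have "vanishes_to_order (Suc n) p (\<lambda>x. dzbar f x * g x + f x * dzbar g x)"
    using Suc.prems
    by (intro vanishes_to_order_add vanishes_to_order_mult_smooth[OF _ _ Suc.prems(4)] Suc.IH sm) auto
  then have "vanishes_to_order (Suc n) p (dzbar (\<lambda>x. f x * g x))"
    by (subst vanishes_to_order_cong[OF S]) (use Wirtinger_mult(2)[OF d] in auto)
  ultimately show ?case unfolding vanishes_to_order.simps(2)[of "Suc n" p "\<lambda>x. f x * g x"]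
    using Suc.prems(3) by simp
qed

lemma vanishes_to_order_cnj:
  "smooth_on S f \<Longrightarrow> vanishes_to_order n p f \<Longrightarrow> vanishes_to_order n p (\<lambda>x. cnj (f x))"
proof (induction n arbitrary: f)
  case (Suc n)
  have d: "f differentiable (at x)" if "x \<in> S" for x
    using Suc.prems(1) smooth_on_differentiable that by blast
  have "vanishes_to_order n p (dz (\<lambda>x. cnj (f x)))"
    using Suc.prems Suc.IH[of "dzbar f"] Wirtinger_cnj(1)[OF d]
    by (subst vanishes_to_order_cong[OF S, of _ "\<lambda>x. cnj (dzbar f x)"]) (auto intro: smooth_on_dzbar S)
  moreover have "vanishes_to_order n p (dzbar (\<lambda>x. cnj (f x)))"
    using Suc.prems Suc.IH[of "dz f"] Wirtinger_cnj(2)[OF d]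
    by (subst vanishes_to_order_cong[OF S, of _ "\<lambda>x. cnj (dz f x)"]) (auto intro: smooth_on_dz S)
  ultimately show ?case using Suc.prems by simp
qed simp

text \<open>
  Taylor's estimate, by induction on the order: both Wirtinger derivatives are of size
  \<open>cmod (x - p) ^ n\<close>, and the mean value inequality on the segment from \<open>p\<close> to \<open>x\<close>
  contributes one more factor.
\<close>
lemma vanishes_to_order_bound:
  "smooth_on S f \<Longrightarrow> vanishes_to_order n p f \<Longrightarrow>
    \<exists>C r. 0 < r \<and> ball p r \<subseteq> S \<and> (\<forall>x\<in>ball p r. cmod (f x) \<le> C * cmod (x - p) ^ n)"
proof (induction n arbitrary: f)
  case 0
  obtain r where r: "r > 0" "cball p r \<subseteq> S" using S open_contains_cball by blast
  have "compact (f ` cball p r)"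
    using smooth_on_continuous[OF 0(1)] r by (intro compact_continuous_image) (auto intro: continuous_on_subset)
  then obtain C where "\<forall>y\<in>f ` cball p r. cmod y \<le> C" using compact_imp_bounded bounded_iff by blast
  then show ?case using r by (intro exI[of _ C] exI[of _ r]) auto
next
  case (Suc n)
  obtain C1 r1 where 1: "0 < r1" "ball p r1 \<subseteq> S" "\<And>x. x \<in> ball p r1 \<Longrightarrow> cmod (dz f x) \<le> C1 * cmod (x - p) ^ n"
    using Suc.IH[OF smooth_on_dz[OF S(1) Suc.prems(1)]] Suc.prems(2) by (metis vanishes_to_order.simps(2))
  obtain C2 r2 where 2: "0 < r2" "ball p r2 \<subseteq> S" "\<And>x. x \<in> ball p r2 \<Longrightarrow> cmod (dzbar f x) \<le> C2 * cmod (x - p) ^ n"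
    using Suc.IH[OF smooth_on_dzbar[OF S(1) Suc.prems(1)]] Suc.prems(2) by (metis vanishes_to_order.simps(2))
  define r where "r = min r1 r2"
  have "cmod (f x) \<le> (\<bar>C1\<bar> + \<bar>C2\<bar>) * cmod (x - p) ^ Suc n" if x: "x \<in> ball p r" for x
  proof -
    have seg: "y \<in> ball p r \<and> cmod (y - p) \<le> cmod (x - p)" if "y \<in> closed_segment p x" for y
      using segment_bound(1)[OF that] x by (auto simp: dist_norm norm_minus_commute)
    have "cmod (f x - f p) \<le> ((\<bar>C1\<bar> + \<bar>C2\<bar>) * cmod (x - p) ^ n) * cmod (x - p)"
    proof (rule differentiable_bound[where S = "closed_segment p x"
            and f' = "\<lambda>y v. dz f y * v + dzbar f y * cnj v"])
      fix y assume y: "y \<in> closed_segment p x"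
      then have yr: "y \<in> ball p r1" "y \<in> ball p r2" using seg[OF y] by (auto simp: r_def)
      then have "y \<in> S" using 1(2) by blast
      then show "(f has_derivative (\<lambda>v. dz f y * v + dzbar f y * cnj v)) (at y within closed_segment p x)"
        using has_derivative_Wirtinger[OF smooth_on_differentiable[OF Suc.prems(1)]]
          has_derivative_at_withinI by blast
      have pw: "cmod (y - p) ^ n \<le> cmod (x - p) ^ n" using seg[OF y] by (intro power_mono) auto
      have "cmod (dz f y) \<le> \<bar>C1\<bar> * cmod (x - p) ^ n"
        using 1(3)[OF yr(1)] mult_mono[OF abs_ge_self[of C1] pw] by simp
      moreover have "cmod (dzbar f y) \<le> \<bar>C2\<bar> * cmod (x - p) ^ n"
        using 2(3)[OF yr(2)] mult_mono[OF abs_ge_self[of C2] pw] by simp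
      ultimately have le: "cmod (dz f y) + cmod (dzbar f y) \<le> (\<bar>C1\<bar> + \<bar>C2\<bar>) * cmod (x - p) ^ n"
        by (simp add: algebra_simps)
      show "onorm (\<lambda>v. dz f y * v + dzbar f y * cnj v) \<le> (\<bar>C1\<bar> + \<bar>C2\<bar>) * cmod (x - p) ^ n"
      proof (rule onorm_le)
        fix v
        have "cmod (dz f y * v + dzbar f y * cnj v) \<le> (cmod (dz f y) + cmod (dzbar f y)) * cmod v"
          using norm_triangle_ineq[of "dz f y * v" "dzbar f y * cnj v"] by (simp add: norm_mult algebra_simps)
        also have "\<dots> \<le> (\<bar>C1\<bar> + \<bar>C2\<bar>) * cmod (x - p) ^ n * cmod v"
          by (rule mult_right_mono[OF le]) simp
        finally show "cmod (dz f y * v + dzbar f y * cnj v) \<le> (\<bar>C1\<bar> + \<bar>C2\<bar>) * cmod (x - p) ^ n * cmod v" .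
      qed
    qed auto
    then show ?thesis using Suc.prems by (simp add: mult_ac)
  qed
  moreover have "r > 0" "ball p r \<subseteq> S" using 1 2 by (auto simp: r_def)
  ultimately show ?case by blast
qed

text \<open>
  The homogeneous Taylor term of degree \<open>n\<close> is a combination of monomials in \<open>x - p\<close> and
  its conjugate. Every monomial that contains the conjugate is detected by a derivative of
  \<open>dzbar f\<close> of order \<open>n - 1\<close>, so only \<open>(x - p) ^ n\<close> survives. In the induction the
  monomial for \<open>f\<close> is the primitive of the one for \<open>dz f\<close>.
\<close>
lemma leading_monomial:
  "smooth_on S f \<Longrightarrow> vanishes_to_order n p f \<Longrightarrow> vanishes_to_order n p (dzbar f) \<Longrightarrow>
    \<exists>A. vanishes_to_order (Suc n) p (\<lambda>x. f x - A * (x - p) ^ n)"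
proof (induction n arbitrary: f)
  case 0
  then show ?case by auto
next
  case (Suc n)
  have "dzbar (dz f) x = dz (dzbar f) x" if "x \<in> S" for x
    using dz_dzbar_commute[OF S(1) that Suc.prems(1)] by simp
  then have "vanishes_to_order n p (dzbar (dz f))"
    using Suc.prems(3) vanishes_to_order_cong[OF S, of "dzbar (dz f)" "dz (dzbar f)"] by simp
  then obtain A where A: "vanishes_to_order (Suc n) p (\<lambda>x. dz f x - A * (x - p) ^ n)"
    using Suc.IH[of "dz f"] Suc.prems smooth_on_dz[OF S(1)] by auto
  define B where "B = A / of_nat (Suc n)"
  let ?h = "\<lambda>x. f x - B * (x - p) ^ Suc n"
  have poly: "((\<lambda>x. - (B * (x - p) ^ Suc n)) has_field_derivative - (A * (x - p) ^ n)) (at x)" for x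
    by (auto intro!: derivative_eq_intros simp: B_def simp del: power_Suc of_nat_Suc)
  have diff: "f differentiable (at x)" if "x \<in> S" for x
    using smooth_on_differentiable Suc.prems(1) that by blast
  have d: "dz ?h x = dz f x - A * (x - p) ^ n" "dzbar ?h x = dzbar f x" if "x \<in> S" for x
    using Wirtinger_add[OF diff[OF that] field_differentiable_imp_differentiable, of "\<lambda>x. - (B * (x - p) ^ Suc n)"]
      Wirtinger_holomorphic[OF poly[of x]] poly[of x]
    unfolding field_differentiable_def by auto
  have "vanishes_to_order (Suc n) p (dz ?h)"
    by (subst vanishes_to_order_cong[OF S d(1)]) (auto simp: A[simplified])
  moreover have "vanishes_to_order (Suc n) p (dzbar ?h)"
    using vanishes_to_order_cong[OF S, of "dzbar ?h" "dzbar f"] d(2) Suc.prems(3) by blast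
  moreover have "?h p = 0" using Suc.prems(2) by simp
  ultimately have "vanishes_to_order (Suc (Suc n)) p ?h"
    unfolding vanishes_to_order.simps(2)[of "Suc n" p ?h] by blast
  then show ?case by blast
qed

end

section \<open>Integral and differential inequalities\<close>

lemma square_integral_le:
  fixes f :: "real \<Rightarrow> real"
  assumes "a \<le> b" "continuous_on {a..b} f"
  shows "(integral {a..b} f)\<^sup>2 \<le> (b - a) * integral {a..b} (\<lambda>x. (f x)\<^sup>2)"
proof (cases "a = b")
  case False
  define m where "m = integral {a..b} f / (b - a)"
  have ab: "b - a > 0" using assms False by simp
  have int: "f integrable_on {a..b}" "(\<lambda>x. (f x)\<^sup>2) integrable_on {a..b}"
    using assms by (auto intro!: integrable_continuous_interval continuous_intros)
  have "0 \<le> integral {a..b} (\<lambda>x. (f x - m)\<^sup>2)"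
    using assms by (intro integral_nonneg integrable_continuous_interval continuous_intros) auto
  also have "\<dots> = integral {a..b} (\<lambda>x. (f x)\<^sup>2 - 2 * m * f x + m\<^sup>2)"
    by (simp add: power2_eq_square algebra_simps)
  also have "\<dots> = integral {a..b} (\<lambda>x. (f x)\<^sup>2) - 2 * m * integral {a..b} f + m\<^sup>2 * (b - a)"
  proof -
    have "((\<lambda>x. (f x)\<^sup>2 - 2 * m * f x + m\<^sup>2) has_integral
        integral {a..b} (\<lambda>x. (f x)\<^sup>2) - 2 * m * integral {a..b} f + m\<^sup>2 * (b - a)) {a..b}"
      using has_integral_const_real[of "m\<^sup>2" a b] assms(1)
      by (intro has_integral_add has_integral_diff has_integral_mult_right integrable_integral int)
         (auto simp: mult.commute)
    then show ?thesis by (rule integral_unique)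
  qed
  also have "\<dots> = integral {a..b} (\<lambda>x. (f x)\<^sup>2) - (integral {a..b} f)\<^sup>2 / (b - a)"
  proof -
    have e: "m * (b - a) = integral {a..b} f" using ab by (simp add: m_def)
    then have "m\<^sup>2 * (b - a) = m * integral {a..b} f" by (metis mult.assoc power2_eq_square)
    moreover have "m * integral {a..b} f = (integral {a..b} f)\<^sup>2 / (b - a)"
      by (simp add: m_def power2_eq_square)
    ultimately show ?thesis by simp
  qed
  finally show ?thesis using ab by (simp add: field_simps)
qed simp

text \<open>
  An oscillation on a circle costs energy: this is Cauchy-Schwarz on the interval between the two
  points.
\<close>
lemma square_increment_le:
  fixes f f' :: "real \<Rightarrow> real"
  assumes f: "\<And>x. x \<in> {a..b} \<Longrightarrow> (f has_real_derivative f' x) (at x)"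
    and f': "continuous_on {a..b} f'" and xy: "x \<in> {a..b}" "y \<in> {a..b}"
  shows "(f x - f y)\<^sup>2 \<le> (b - a) * integral {a..b} (\<lambda>x. (f' x)\<^sup>2)"
proof -
  have *: "(f y - f x)\<^sup>2 \<le> (b - a) * integral {a..b} (\<lambda>x. (f' x)\<^sup>2)"
    if xy: "x \<in> {a..b}" "y \<in> {a..b}" "x \<le> y" for x y
  proof -
    have sub: "{x..y} \<subseteq> {a..b}" using xy by auto
    have int: "(\<lambda>x. (f' x)\<^sup>2) integrable_on {a..b}" "(\<lambda>x. (f' x)\<^sup>2) integrable_on {x..y}"
      using f' continuous_on_subset[OF f' sub]
      by (auto intro!: integrable_continuous_interval continuous_intros)
    have "f y - f x = integral {x..y} f'"
      using fundamental_theorem_of_calculus[of x y f f'] xy f sub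
      by (metis (no_types, lifting) DERIV_subset has_real_derivative_iff_has_vector_derivative
          integral_unique subset_UNIV subsetD)
    then have "(f y - f x)\<^sup>2 \<le> (y - x) * integral {x..y} (\<lambda>x. (f' x)\<^sup>2)"
      using square_integral_le[OF xy(3) continuous_on_subset[OF f' sub]] by simp
    also have "\<dots> \<le> (b - a) * integral {a..b} (\<lambda>x. (f' x)\<^sup>2)"
      using xy integral_subset_le[OF sub int(2,1)] integral_nonneg[OF int(2)]
      by (intro mult_mono) auto
    finally show ?thesis .
  qed
  show ?thesis
    using *[of x y] *[of y x] xy by (cases "x \<le> y") (auto simp: power2_commute)
qed

text \<open>
  A positive solution of \<open>f' \<ge> c f\<^sup>2\<close> blows up in finite time, since \<open>1 / f + c t\<close> is
  nonincreasing. If it still exists at time \<open>b\<close>, it cannot have been large at time \<open>a\<close>,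
  whatever its value at \<open>b\<close> is.
\<close>
lemma Riccati_bound:
  fixes f :: "real \<Rightarrow> real"
  assumes "a < b" "c > 0"
    and f: "\<And>t. a \<le> t \<Longrightarrow> t \<le> b \<Longrightarrow> (f has_real_derivative f' t) (at t)"
    and le: "\<And>t. a \<le> t \<Longrightarrow> t \<le> b \<Longrightarrow> c * (f t)\<^sup>2 \<le> f' t"
  shows "f a \<le> 1 / (c * (b - a))"
proof (cases "f a \<le> 0")
  case True
  then show ?thesis using assms(1,2) by (smt (verit) divide_nonneg_pos mult_pos_pos)
next
  case False
  have pos: "f t > 0" if t: "a \<le> t" "t \<le> b" for t
  proof -
    have "f a \<le> f t"
    proof (rule DERIV_nonneg_imp_nondecreasing[OF t(1)])
      fix x assume x: "a \<le> x" "x \<le> t"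
      have "0 \<le> c * (f x)\<^sup>2" using assms(2) by simp
      then show "\<exists>y. (f has_real_derivative y) (at x) \<and> 0 \<le> y"
        using f[of x] le[of x] x t by (intro exI[of _ "f' x"]) linarith
    qed
    then show ?thesis using False by simp
  qed
  have "1 / f b + c * b \<le> 1 / f a + c * a"
  proof (rule DERIV_nonpos_imp_nonincreasing[where f = "\<lambda>t. 1 / f t + c * t"])
    fix x assume x: "a \<le> x" "x \<le> b"
    have "((\<lambda>t. 1 / f t + c * t) has_real_derivative - f' x / (f x)\<^sup>2 + c) (at x)"
      using f[OF x] pos[OF x] by (auto intro!: derivative_eq_intros simp: power2_eq_square)
    moreover have "- f' x / (f x)\<^sup>2 + c \<le> 0"
      using le[OF x] pos[OF x] by (simp add: field_simps)
    ultimately show "\<exists>y. ((\<lambda>t. 1 / f t + c * t) has_real_derivative y) (at x) \<and> y \<le> 0" by blast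
  qed (use assms in simp)
  moreover have "1 / f b > 0" using pos[of b] assms(1) by simp
  ultimately have "c * (b - a) \<le> 1 / f a" unfolding right_diff_distrib by linarith
  then show ?thesis using False assms(1,2) by (simp add: field_simps)
qed

section \<open>Weighted fluxes of quasiregular maps on a cylinder\<close>

lemma DERIV_Re_Im_cnj_mult:
  assumes "(u has_vector_derivative u') (at t within A)" "(v has_vector_derivative v') (at t within A)"
  shows "((\<lambda>t. Re (cnj (u t) * v t)) has_real_derivative Re (cnj u' * v t + cnj (u t) * v')) (at t within A)"
    and "((\<lambda>t. Im (cnj (u t) * v t)) has_real_derivative Im (cnj u' * v t + cnj (u t) * v')) (at t within A)"
proof -
  have "((\<lambda>t. cnj (u t) * v t) has_vector_derivative cnj u' * v t + cnj (u t) * v') (at t within A)"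
    using has_vector_derivative_mult[OF has_vector_derivative_cnj[OF assms(1)] assms(2)] by (simp add: add.commute)
  then show "((\<lambda>t. Re (cnj (u t) * v t)) has_real_derivative Re (cnj u' * v t + cnj (u t) * v')) (at t within A)"
    and "((\<lambda>t. Im (cnj (u t) * v t)) has_real_derivative Im (cnj u' * v t + cnj (u t) * v')) (at t within A)"
    unfolding has_vector_derivative_complex_iff by blast+
qed

text \<open>
  Logarithmic polar coordinates: \<open>U \<tau>\<close> stands for \<open>u (p + exp \<tau>)\<close>, so that the circles
  around \<open>p\<close> become the segments of length \<open>2 * pi\<close> on the lines \<open>Re \<tau> = t\<close>, and
  \<open>p\<close> itself is moved to \<open>t = -\<infinity>\<close>. Composition with \<open>exp\<close> is conformal and
  preserves the distortion inequalities \<open>distortion\<close>, which express that \<open>u\<close> is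
  quasiregular: \<open>J\<close> is the Jacobian of \<open>U\<close>. The bound \<open>1/16\<close> keeps
  \<open>ln (1 / (q + \<epsilon>))\<close> above \<open>1\<close> for small \<open>\<epsilon>\<close>.
\<close>
locale quasiregular_cylinder =
  fixes U Ut Uth :: "complex \<Rightarrow> complex" and T0 K :: real and H :: "complex set" and q J :: "complex \<Rightarrow> real"
  defines "H \<equiv> {\<tau>. Re \<tau> < T0}"
    and "Ut \<equiv> (\<lambda>\<tau>. frechet_derivative U (at \<tau>) 1)" and "Uth \<equiv> (\<lambda>\<tau>. frechet_derivative U (at \<tau>) \<i>)"
    and "q \<equiv> (\<lambda>\<tau>. (cmod (U \<tau>))\<^sup>2)"
    and "J \<equiv> (\<lambda>\<tau>. Im (cnj (Ut \<tau>) * Uth \<tau>))"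
  assumes smooth: "smooth_on H U"
    and periodic: "U (\<tau> + 2 * of_real pi * \<i>) = U \<tau>"
    and small: "\<tau> \<in> H \<Longrightarrow> q \<tau> \<le> 1/16"
    and K: "K > 0"
    and distortion: "\<tau> \<in> H \<Longrightarrow> (cmod (Ut \<tau>))\<^sup>2 \<le> K * J \<tau>" "\<tau> \<in> H \<Longrightarrow> (cmod (Uth \<tau>))\<^sup>2 \<le> K * J \<tau>"
    and decay: "\<exists>B. \<forall>\<tau>\<in>H. cmod (Uth \<tau>) \<le> B * exp (Re \<tau>)"
begin

lemma open_H: "open H"
  unfolding H_def by (simp add: open_halfspace_Re_lt)

lemma in_H [simp]: "Complex t \<theta> \<in> H \<longleftrightarrow> t < T0"
  by (simp add: H_def)

lemma J_nonneg: "\<tau> \<in> H \<Longrightarrow> J \<tau> \<ge> 0"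
  using distortion(1)[of \<tau>] K by (smt (verit) zero_le_power2 zero_le_mult_iff)

lemma q_nonneg [simp]: "q \<tau> \<ge> 0"
  by (simp add: q_def)

abbreviation "Utth \<equiv> (\<lambda>\<tau>. frechet_derivative Uth (at \<tau>) 1)"

lemma smooth_Ut: "smooth_on H Ut" and smooth_Uth: "smooth_on H Uth" and smooth_Utth: "smooth_on H Utth"
  using smooth_on_frechet_derivative[OF smooth]
    smooth_on_frechet_derivative[OF smooth_on_frechet_derivative[OF smooth]]
  unfolding Ut_def Uth_def by blast+

lemmas cont = smooth_on_continuous[OF smooth] smooth_on_continuous[OF smooth_Ut]
  smooth_on_continuous[OF smooth_Uth] smooth_on_continuous[OF smooth_Utth]

lemma cont_q: "continuous_on H q" and cont_J: "continuous_on H J"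
  unfolding q_def J_def by (intro continuous_intros cont)+

lemma cont_comp_q: "continuous_on {0..1/16} g \<Longrightarrow> continuous_on H (\<lambda>\<tau>. g (q \<tau>))"
  by (rule continuous_on_compose2[OF _ cont_q]) (use small in auto)

lemma along_t:
  assumes "smooth_on H F" "t < T0"
  shows "((\<lambda>t. F (Complex t \<theta>)) has_vector_derivative frechet_derivative F (at (Complex t \<theta>)) 1) (at t within A)"
proof -
  have "((\<lambda>t. Complex t \<theta>) has_vector_derivative 1) (at t within A)"
    unfolding Complex_eq by (auto intro!: derivative_eq_intros simp: has_vector_derivative_def scaleR_conv_of_real)
  from vector_derivative_diff_chain_within[OF this
      has_derivative_at_withinI[OF smooth_on_has_derivative[OF assms(1)]]]
  show ?thesis using assms(2) by (simp add: o_def)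
qed

lemma along_theta:
  assumes "smooth_on H F" "t < T0"
  shows "((\<lambda>\<theta>. F (Complex t \<theta>)) has_vector_derivative frechet_derivative F (at (Complex t \<theta>)) \<i>) (at \<theta> within A)"
proof -
  have "((\<lambda>\<theta>. Complex t \<theta>) has_vector_derivative \<i>) (at \<theta> within A)"
    unfolding Complex_eq by (auto intro!: derivative_eq_intros simp: has_vector_derivative_def scaleR_conv_of_real)
  from vector_derivative_diff_chain_within[OF this
      has_derivative_at_withinI[OF smooth_on_has_derivative[OF assms(1)]]]
  show ?thesis using assms(2) by (simp add: o_def)
qed

text \<open>
  By Schwarz' theorem \<open>Utth\<close>, which is defined as a derivative of \<open>Uth\<close>, also serves as the
  other mixed derivative; the second order terms in Stokes' theorem cancel for this reason.
\<close>
lemma Ut_along_theta: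
  "t < T0 \<Longrightarrow> ((\<lambda>\<theta>. Ut (Complex t \<theta>)) has_vector_derivative Utth (Complex t \<theta>)) (at \<theta> within A)"
  using along_theta[OF smooth_Ut, of t \<theta> A] smooth_on_frechet_derivative_commute[OF open_H _ smooth, of "Complex t \<theta>" 1 \<i>]
  by (simp add: Ut_def[symmetric] Uth_def[symmetric])

lemma periodic_Ut: "Ut (\<tau> + 2 * of_real pi * \<i>) = Ut \<tau>"
proof -
  have shift: "(U has_derivative D) (at \<tau>)" if D: "(U has_derivative D) (at (\<tau> + w))" and U: "\<And>\<sigma>. U (\<sigma> + w) = U \<sigma>" for D \<tau> w
  proof -
    have "((\<lambda>\<sigma>. \<sigma> + w) has_derivative (\<lambda>v. v)) (at \<tau>)" by (auto intro!: derivative_eq_intros)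
    from has_derivative_compose[OF this D] show ?thesis by (simp add: U)
  qed
  have "U (\<sigma> - 2 * of_real pi * \<i>) = U \<sigma>" for \<sigma>
    using periodic[of "\<sigma> - 2 * of_real pi * \<i>"] by simp
  then have "(U has_derivative D) (at (\<tau> + 2 * of_real pi * \<i>)) \<longleftrightarrow> (U has_derivative D) (at \<tau>)" for D
    using shift[of D \<tau> "2 * of_real pi * \<i>"] shift[of D "\<tau> + 2 * of_real pi * \<i>" "- (2 * of_real pi * \<i>)"] periodic
    by auto
  then show ?thesis by (simp add: Ut_def frechet_derivative_def)
qed

definition circle_integral :: "(complex \<Rightarrow> real) \<Rightarrow> real \<Rightarrow> real" where
  "circle_integral F t = integral {0..2*pi} (\<lambda>\<theta>. F (Complex t \<theta>))"

lemma circle_cont: "continuous_on H F \<Longrightarrow> t < T0 \<Longrightarrow> continuous_on A (\<lambda>\<theta>. F (Complex t \<theta>))"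
  by (rule continuous_on_compose2[of H F _ "Complex t"])
     (auto intro!: continuous_intros)

lemma circle_integrable:
  "continuous_on H F \<Longrightarrow> t < T0 \<Longrightarrow> (\<lambda>\<theta>. F (Complex t \<theta>)) integrable_on {0..2*pi}"
  for F :: "complex \<Rightarrow> real"
  by (intro integrable_continuous_interval circle_cont)

lemma circle_integral_mono:
  assumes "continuous_on H F" "continuous_on H G" "t < T0" "\<And>\<theta>. \<theta> \<in> {0..2*pi} \<Longrightarrow> F (Complex t \<theta>) \<le> G (Complex t \<theta>)"
  shows "circle_integral F t \<le> circle_integral G t"
  unfolding circle_integral_def using assms by (intro integral_le circle_integrable) auto

lemma circle_integral_const: "circle_integral (\<lambda>\<tau>. c) t = 2 * pi * c"
  by (simp add: circle_integral_def)

lemma circle_integral_add: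
  "continuous_on H F \<Longrightarrow> continuous_on H G \<Longrightarrow> t < T0 \<Longrightarrow>
    circle_integral (\<lambda>\<tau>. F \<tau> + G \<tau>) t = circle_integral F t + circle_integral G t"
  unfolding circle_integral_def by (intro integral_add circle_integrable)

lemma circle_integral_cmult: "circle_integral (\<lambda>\<tau>. c * F \<tau>) t = c * circle_integral F t"
  by (simp add: circle_integral_def)

lemma DERIV_circle_integral:
  assumes "continuous_on H F" "continuous_on H F'" "t < T0"
    and "\<And>t \<theta>. t < T0 \<Longrightarrow> ((\<lambda>t. F (Complex t \<theta>)) has_real_derivative F' (Complex t \<theta>)) (at t)"
  shows "(circle_integral F has_real_derivative circle_integral F' t) (at t)"
proof -
  have "((\<lambda>t. integral (cbox 0 (2*pi)) (\<lambda>\<theta>. F (Complex t \<theta>))) has_field_derivative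
      integral (cbox 0 (2*pi)) (\<lambda>\<theta>. F' (Complex t \<theta>))) (at t within {..<T0})"
  proof (rule leibniz_rule_field_derivative)
    show "continuous_on ({..<T0} \<times> cbox 0 (2 * pi)) (\<lambda>(t, \<theta>). F' (Complex t \<theta>))"
      unfolding case_prod_unfold
      by (rule continuous_on_compose2[OF assms(2), of _ "\<lambda>x. Complex (fst x) (snd x)"])
         (auto intro!: continuous_intros)
    show "(\<lambda>\<theta>. F (Complex t \<theta>)) integrable_on cbox 0 (2 * pi)" if "t \<in> {..<T0}" for t
      using circle_integrable[OF assms(1)] that by simp
    show "((\<lambda>t. F (Complex t \<theta>)) has_real_derivative F' (Complex t \<theta>)) (at t within {..<T0})"
      if "t \<in> {..<T0}" for t \<theta>
      using DERIV_subset[OF assms(4)] that by blast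
  qed (use assms(3) in auto)
  moreover have "at t within {..<T0} = at t" using assms(3) by (intro at_within_open) auto
  ultimately show ?thesis by (simp add: circle_integral_def[abs_def])
qed

lemma q_eq: "q \<tau> = Re (cnj (U \<tau>) * U \<tau>)"
  unfolding q_def cmod_power2 by (simp add: power2_eq_square)

lemma q_along_t:
  assumes "t < T0"
  shows "((\<lambda>t. q (Complex t \<theta>)) has_real_derivative 2 * Re (cnj (U (Complex t \<theta>)) * Ut (Complex t \<theta>))) (at t within A)"
  using DERIV_Re_Im_cnj_mult(1)[OF along_t[OF smooth assms, of \<theta> A] along_t[OF smooth assms, of \<theta> A]]
  by (simp add: q_eq Ut_def algebra_simps)

lemma q_along_theta:
  assumes "t < T0"
  shows "((\<lambda>\<theta>. q (Complex t \<theta>)) has_real_derivative 2 * Re (cnj (U (Complex t \<theta>)) * Uth (Complex t \<theta>))) (at \<theta> within A)"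
  using DERIV_Re_Im_cnj_mult(1)[OF along_theta[OF smooth assms, of \<theta> A] along_theta[OF smooth assms, of \<theta> A]]
  by (simp add: q_eq Uth_def algebra_simps)

abbreviation "X \<equiv> (\<lambda>\<tau>. Im (cnj (U \<tau>) * Uth \<tau>))"
abbreviation "Y \<equiv> (\<lambda>\<tau>. Im (cnj (U \<tau>) * Ut \<tau>))"

text \<open>
  \<open>X\<close> and \<open>Y\<close> are the components of the one-form \<open>Im (cnj U dU)\<close>, which is
  \<open>(cmod U)\<^sup>2\<close> times the differential of the argument of \<open>U\<close>. The flux is the integral over
  a circle of this form with a weight \<open>g\<close> that depends on \<open>(cmod U)\<^sup>2\<close>; for
  \<open>g x = 1 / x\<close> it is \<open>2 * pi\<close> times the winding number.
\<close>
definition flux :: "(real \<Rightarrow> real) \<Rightarrow> real \<Rightarrow> real" where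
  "flux g = circle_integral (\<lambda>\<tau>. g (q \<tau>) * X \<tau>)"

text \<open>
  Stokes' theorem on the cylinder. The exterior derivative of \<open>g(q) Im (cnj U dU)\<close> is
  \<open>2 J\<close> times the derivative of \<open>x g(x)\<close> at \<open>q\<close>. The \<open>\<theta>\<close>-derivative of the
  other component integrates to zero by periodicity.
\<close>
lemma DERIV_flux:
  assumes g: "\<And>x. x \<in> {0..1/16} \<Longrightarrow> (g has_real_derivative g' x) (at x)"
    and g': "continuous_on {0..1/16} g'" and t: "t < T0"
  shows "(flux g has_real_derivative circle_integral (\<lambda>\<tau>. 2 * J \<tau> * (g (q \<tau>) + q \<tau> * g' (q \<tau>))) t) (at t)"
proof -
  have cg: "continuous_on {0..1/16} g"
    using g DERIV_isCont by (blast intro: continuous_at_imp_continuous_on)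
  note C = cont cont_q cont_J cont_comp_q[OF cg] cont_comp_q[OF g']
  let ?Pt = "\<lambda>\<tau>. g' (q \<tau>) * (2 * Re (cnj (U \<tau>) * Ut \<tau>)) * X \<tau> + g (q \<tau>) * Im (cnj (Ut \<tau>) * Uth \<tau> + cnj (U \<tau>) * Utth \<tau>)"
  let ?R = "\<lambda>\<tau>. g (q \<tau>) * Y \<tau>"
  let ?Rth = "\<lambda>\<tau>. g' (q \<tau>) * (2 * Re (cnj (U \<tau>) * Uth \<tau>)) * Y \<tau> + g (q \<tau>) * Im (cnj (Uth \<tau>) * Ut \<tau> + cnj (U \<tau>) * Utth \<tau>)"
  have q_in: "q (Complex t \<theta>) \<in> {0..1/16}" if "t < T0" for t \<theta> using small that by simp
  have Pt: "((\<lambda>t. g (q (Complex t \<theta>)) * X (Complex t \<theta>)) has_real_derivative ?Pt (Complex t \<theta>)) (at t)"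
    if t: "t < T0" for t \<theta>
    using DERIV_mult[OF DERIV_chain2[OF g[OF q_in[OF t]] q_along_t[OF t]]
        DERIV_Re_Im_cnj_mult(2)[OF along_t[OF smooth t] along_t[OF smooth_Uth t]], of \<theta>]
    by (simp add: Ut_def mult_ac add_ac)
  have Rth: "((\<lambda>\<theta>. ?R (Complex t \<theta>)) has_real_derivative ?Rth (Complex t \<theta>)) (at \<theta> within A)" for \<theta> A
    using DERIV_mult[OF DERIV_chain2[OF g[OF q_in[OF t]] q_along_theta[OF t]]
        DERIV_Re_Im_cnj_mult(2)[OF along_theta[OF smooth t] Ut_along_theta[OF t]], of \<theta> A]
    by (simp add: Uth_def mult_ac add_ac)
  have "circle_integral ?Rth t = 0"
  proof -
    have "((\<lambda>\<theta>. ?Rth (Complex t \<theta>)) has_integral ?R (Complex t (2*pi)) - ?R (Complex t 0)) {0..2*pi}"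
      by (rule fundamental_theorem_of_calculus)
         (simp_all only: has_real_derivative_iff_has_vector_derivative[symmetric] Rth, simp)
    moreover have "Complex t (2 * pi) = Complex t 0 + 2 * of_real pi * \<i>"
      by (simp add: complex_eq_iff)
    ultimately show ?thesis
      using periodic[of "Complex t 0"] periodic_Ut[of "Complex t 0"]
      by (auto simp: circle_integral_def q_def intro!: integral_unique)
  qed
  moreover have "circle_integral ?Pt t = circle_integral (\<lambda>\<tau>. 2 * J \<tau> * (g (q \<tau>) + q \<tau> * g' (q \<tau>)) + ?Rth \<tau>) t"
  proof -
    have "?Pt \<tau> = 2 * J \<tau> * (g (q \<tau>) + q \<tau> * g' (q \<tau>)) + ?Rth \<tau>" for \<tau>
      unfolding q_eq[of \<tau>] J_def by (simp add: algebra_simps)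
    then show ?thesis by simp
  qed
  moreover have "\<dots> = circle_integral (\<lambda>\<tau>. 2 * J \<tau> * (g (q \<tau>) + q \<tau> * g' (q \<tau>))) t + circle_integral ?Rth t"
    by (rule circle_integral_add[OF _ _ t]) (intro continuous_intros C)+
  moreover have "(flux g has_real_derivative circle_integral ?Pt t) (at t)"
    unfolding flux_def by (rule DERIV_circle_integral[OF _ _ t Pt]) (intro continuous_intros C | simp)+
  ultimately show ?thesis by simp
qed

text \<open>
  The flux is nondecreasing since \<open>J \<ge> 0\<close>, and it tends to zero as \<open>t\<close> tends to
  \<open>-\<infinity>\<close>, where the circles shrink to a point.
\<close>
lemma flux_mono_nonneg:
  assumes g: "\<And>x. x \<in> {0..1/16} \<Longrightarrow> (g has_real_derivative g' x) (at x)"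
    and g': "continuous_on {0..1/16} g'" and pos: "\<And>x. x \<in> {0..1/16} \<Longrightarrow> 0 \<le> g x + x * g' x"
  shows "s \<le> t \<Longrightarrow> t < T0 \<Longrightarrow> flux g s \<le> flux g t" and "t < T0 \<Longrightarrow> 0 \<le> flux g t"
proof -
  have cg: "continuous_on {0..1/16} g"
    using g DERIV_isCont by (blast intro: continuous_at_imp_continuous_on)
  note C = cont cont_q cont_J cont_comp_q[OF cg] cont_comp_q[OF g']
  show mono: "flux g s \<le> flux g t" if "s \<le> t" "t < T0" for s t
  proof (rule DERIV_nonneg_imp_nondecreasing[OF that(1)])
    fix x assume x: "s \<le> x" "x \<le> t"
    have "circle_integral (\<lambda>\<tau>. 0) x \<le> circle_integral (\<lambda>\<tau>. 2 * J \<tau> * (g (q \<tau>) + q \<tau> * g' (q \<tau>))) x"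
      using x that J_nonneg pos small
      by (intro circle_integral_mono continuous_intros C mult_nonneg_nonneg) auto
    then show "\<exists>y. (flux g has_real_derivative y) (at x) \<and> 0 \<le> y"
      using DERIV_flux[OF g g', of x] x that by (intro exI conjI) (auto simp: circle_integral_const)
  qed
  have "compact (g ` {0..1/16})" using cg by (simp add: compact_continuous_image)
  then obtain M where M: "\<forall>y\<in>g ` {0..1/16}. \<bar>y\<bar> \<le> M"
    using compact_imp_bounded bounded_iff[of "g ` {0..1/16}"] by auto
  obtain B where B: "\<And>\<tau>. \<tau> \<in> H \<Longrightarrow> cmod (Uth \<tau>) \<le> B * exp (Re \<tau>)" using decay by blast
  show "0 \<le> flux g t" if t: "t < T0"
  proof (rule tendsto_le[of at_bot])
    have "((\<lambda>s. 2 * pi * (- (M * (B * exp s)))) \<longlongrightarrow> 2 * pi * (- (M * (B * 0)))) at_bot"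
      by (intro tendsto_intros exp_at_bot)
    then show "((\<lambda>s. 2 * pi * (- (M * (B * exp s)))) \<longlongrightarrow> 0) at_bot" by simp
    show "((\<lambda>s. flux g t) \<longlongrightarrow> flux g t) at_bot" by simp
    have "2 * pi * (- (M * (B * exp s))) \<le> flux g t" if s: "s \<le> t" for s
    proof -
      have "- (M * (B * exp s)) \<le> g (q (Complex s \<theta>)) * X (Complex s \<theta>)" for \<theta>
      proof -
        let ?\<tau> = "Complex s \<theta>"
        have H: "?\<tau> \<in> H" using s t by simp
        have "q ?\<tau> \<le> 1" using small[OF H] by simp
        then have "cmod (U ?\<tau>) \<le> 1" by (simp add: q_def power_le_one_iff)
        moreover have "cmod (Uth ?\<tau>) \<le> B * exp s" using B[OF H] by simp
        ultimately have "cmod (U ?\<tau>) * cmod (Uth ?\<tau>) \<le> 1 * (B * exp s)"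
          by (rule mult_mono) auto
        then have "\<bar>X ?\<tau>\<bar> \<le> B * exp s"
          using abs_Im_le_cmod[of "cnj (U ?\<tau>) * Uth ?\<tau>"] by (simp only: norm_mult complex_mod_cnj mult_1)
        moreover have "\<bar>g (q ?\<tau>)\<bar> \<le> M" using M small[OF H] by simp
        ultimately have "\<bar>g (q ?\<tau>) * X ?\<tau>\<bar> \<le> M * (B * exp s)"
          unfolding abs_mult by (intro mult_mono) linarith+
        then show ?thesis by linarith
      qed
      then have "circle_integral (\<lambda>\<tau>. - (M * (B * exp s))) s \<le> flux g s"
        unfolding flux_def using s t by (intro circle_integral_mono continuous_intros C) auto
      then show ?thesis using mono[OF s t] by (simp add: circle_integral_const)
    qed
    then show "\<forall>\<^sub>F s in at_bot. 2 * pi * (- (M * (B * exp s))) \<le> flux g t"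
      by (auto simp: eventually_at_bot_linorder)
  qed simp
qed

section \<open>Zeros of quasiregular maps\<close>

text \<open>
  The zero set of a quasiregular map that is not identically zero has logarithmic capacity zero, so
  it cannot meet every circle. The proof uses the flux with weight
  \<open>g x = 1 / ((x + \<epsilon>) L x)\<close>, \<open>L x = ln (1 / (x + \<epsilon>))\<close>, for which
  \<open>x g(x)\<^sup>2\<close> is at most the derivative of \<open>x g(x)\<close>. Two consequences of the
  distortion inequality play against each other as \<open>\<epsilon>\<close> tends to zero.

  On the one hand the flux satisfies a Riccati inequality, so it is bounded at \<open>t0\<close>
  independently of \<open>\<epsilon>\<close>. On the other hand its derivative dominates the energy on the
  circle of \<open>h(q)\<close>, \<open>h x = ln (L x)\<close>. On a circle that contains a zero and a point with
  \<open>q \<ge> c0\<close> this function oscillates by about \<open>ln (ln (1 / \<epsilon>))\<close>. If every circle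
  with \<open>t\<close> in an interval that ends at \<open>t0\<close> met the zero set, the flux at \<open>t0\<close> would
  have to be arbitrarily large.
\<close>
lemma exists_zero_free_circle:
  assumes t0: "t0 < T0" and \<theta>0: "\<theta>0 \<in> {0..2*pi}" and nz: "U (Complex t0 \<theta>0) \<noteq> 0"
  shows "\<exists>T<T0. \<forall>\<theta>\<in>{0..2*pi}. U (Complex T \<theta>) \<noteq> 0"
proof (rule ccontr)
  assume "\<not> ?thesis"
  then have zero: "\<exists>\<theta>\<in>{0..2*pi}. U (Complex t \<theta>) = 0" if "t < T0" for t using that by blast
  define c0 where "c0 = q (Complex t0 \<theta>0) / 2"
  have c0: "c0 > 0" "c0 < 1/16" using nz small[of "Complex t0 \<theta>0"] t0 by (auto simp: c0_def q_def)
  obtain \<eta> where \<eta>: "\<eta> > 0" "\<And>t. t0 - \<eta> \<le> t \<Longrightarrow> t \<le> t0 \<Longrightarrow> c0 \<le> q (Complex t \<theta>0)"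
  proof -
    have "continuous_on {..<T0} (\<lambda>t. q (Complex t \<theta>0))"
      by (rule continuous_on_compose2[OF cont_q, of _ "\<lambda>t. Complex t \<theta>0"]) (auto intro!: continuous_intros)
    then have "isCont (\<lambda>t. q (Complex t \<theta>0)) t0"
      using t0 by (simp add: continuous_on_eq_continuous_at)
    then have "\<exists>d>0. \<forall>t. \<bar>t - t0\<bar> < d \<longrightarrow> \<bar>q (Complex t \<theta>0) - q (Complex t0 \<theta>0)\<bar> < c0"
      using c0(1) unfolding continuous_at_eps_delta by (simp add: dist_real_def)
    then obtain d where d: "d > 0" "\<And>t. \<bar>t - t0\<bar> < d \<Longrightarrow> \<bar>q (Complex t \<theta>0) - 2 * c0\<bar> < c0"
      by (auto simp: c0_def)
    show thesis
    proof (rule that[of "d/2"])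
      fix t assume "t0 - d/2 \<le> t" "t \<le> t0"
      then have "\<bar>t - t0\<bar> < d" using d(1) by simp
      from d(2)[OF this] show "c0 \<le> q (Complex t \<theta>0)" by linarith
    qed (use d in simp)
  qed
  \<comment> \<open>\<open>bd\<close> is the Riccati bound for the flux at \<open>t0\<close>; \<open>M\<close> is the value of \<open>h\<close> at a zero of
    \<open>U\<close> and \<open>a\<close> bounds \<open>h\<close> at \<open>\<theta>0\<close>. The number \<open>M\<close> is so large that the growth
    of the flux over a time \<open>\<eta>\<close> exceeds \<open>bd\<close>.\<close>
  define T' where "T' = (t0 + T0) / 2"
  have T': "t0 < T'" "T' < T0" using t0 by (auto simp: T'_def)
  define a where "a = ln (- ln c0)"
  define bd where "bd = pi * K / (T' - t0)"
  define M where "M = \<bar>a\<bar> + 1 + 4 * pi * K * (bd / \<eta> + 1)"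
  have bd: "bd > 0" using K T' by (simp add: bd_def)
  have Ma: "M \<ge> a" "M - a \<ge> 1" "M - a \<ge> 4 * pi * K * (bd / \<eta> + 1)"
  proof -
    have "0 \<le> 4 * pi * K * (bd / \<eta> + 1)"
      using bd K \<eta>(1) by (intro mult_nonneg_nonneg add_nonneg_nonneg) auto
    then show "M \<ge> a" "M - a \<ge> 1" "M - a \<ge> 4 * pi * K * (bd / \<eta> + 1)" unfolding M_def by linarith+
  qed
  \<comment> \<open>solves \<open>ln (ln (1 / \<epsilon>)) = M\<close>\<close>
  define \<epsilon> where "\<epsilon> = exp (- exp M)"
  have lnc0: "- ln c0 > 1"
  proof -
    have "exp (1::real) < 16" using exp_le by linarith
    then have "ln (16::real) > 1" by (metis exp_less_cancel_iff exp_ln zero_less_numeral)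
    moreover have "ln c0 < ln (1/16)" using c0 by (intro ln_less_cancel_iff[THEN iffD2]) auto
    ultimately show ?thesis by (simp add: ln_div)
  qed
  have \<epsilon>: "\<epsilon> > 0" "\<epsilon> \<le> c0" "ln (- ln \<epsilon>) = M"
  proof -
    have "exp a \<le> exp M" using Ma by simp
    then have "- exp M \<le> ln c0" using lnc0 by (simp add: a_def)
    then have "\<epsilon> \<le> exp (ln c0)" unfolding \<epsilon>_def by (simp only: exp_le_cancel_iff)
    then show "\<epsilon> \<le> c0" using c0 by simp
  qed (simp_all add: \<epsilon>_def)
  define L where "L x = - ln (x + \<epsilon>)" for x
  define g where "g x = 1 / ((x + \<epsilon>) * L x)" for x
  define g' where "g' x = (1 - L x) / ((x + \<epsilon>) * L x)\<^sup>2" for x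
  define h where "h x = ln (L x)" for x
  have xe: "0 < x + \<epsilon>" "x + \<epsilon> < 1/4" "L x > 1" if "x \<in> {0..1/16}" for x
  proof -
    show 1: "0 < x + \<epsilon>" "x + \<epsilon> < 1/4" using that \<epsilon> c0 by auto
    have "exp (1::real) < 4" using exp_le by linarith
    then have "ln (4::real) > 1" by (metis exp_less_cancel_iff exp_ln zero_less_numeral)
    moreover have "ln (x + \<epsilon>) < ln (1/4)" using 1 by (intro ln_less_cancel_iff[THEN iffD2]) auto
    ultimately show "L x > 1" by (simp add: L_def ln_div)
  qed
  have L': "(L has_real_derivative - (1 / (x + \<epsilon>))) (at x)" if "x \<in> {0..1/16}" for x
    unfolding L_def using xe(1)[OF that] by (auto intro!: derivative_eq_intros)
  have Dg: "(g has_real_derivative g' x) (at x)" if "x \<in> {0..1/16}" for x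
  proof -
    have "((\<lambda>x. (x + \<epsilon>) * L x) has_real_derivative L x - 1) (at x)"
    proof -
      have "((\<lambda>x. x + \<epsilon>) has_real_derivative 1) (at x)" by (auto intro!: derivative_eq_intros)
      from DERIV_mult[OF this L'[OF that]] show ?thesis using xe(1)[OF that] by simp
    qed
    from DERIV_divide[OF DERIV_const[of 1] this] show ?thesis
      unfolding g_def g'_def using xe[OF that] by (simp add: power2_eq_square)
  qed
  have Dh: "(h has_real_derivative - g x) (at x)" if "x \<in> {0..1/16}" for x
    unfolding h_def g_def using xe[OF that] by (auto intro!: derivative_eq_intros L'[OF that])
  have cL: "continuous_on {0..1/16} L"
    using L' DERIV_isCont by (blast intro: continuous_at_imp_continuous_on)
  have cg: "continuous_on {0..1/16} g"
    using Dg DERIV_isCont by (blast intro: continuous_at_imp_continuous_on)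
  have cg': "continuous_on {0..1/16} g'"
    unfolding g'_def using xe by (intro continuous_intros cL) force
  note C = cont cont_q cont_J cont_comp_q[OF cg] cont_comp_q[OF cg']
  have G': "x * (g x)\<^sup>2 \<le> g x + x * g' x" if "x \<in> {0..1/16}" for x
  proof -
    note xe = xe[OF that]
    let ?d = "(x + \<epsilon>) * L x"
    have d: "?d > 0" using xe by simp
    have "g x + x * g' x = (?d + x * (1 - L x)) / ?d\<^sup>2"
    proof -
      have "1 / y + x * (B / y\<^sup>2) = (y + x * B) / y\<^sup>2" if "y \<noteq> 0" for y B :: real
        using that by (simp add: add_divide_distrib power2_eq_square)
      moreover have "?d \<noteq> 0" using d by linarith
      ultimately have "1 / ?d + x * ((1 - L x) / ?d\<^sup>2) = (?d + x * (1 - L x)) / ?d\<^sup>2" by blast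
      then show ?thesis unfolding g_def g'_def .
    qed
    also have "?d + x * (1 - L x) = x + \<epsilon> * L x" by (simp add: algebra_simps)
    also have "x / ?d\<^sup>2 \<le> (x + \<epsilon> * L x) / ?d\<^sup>2"
      using xe \<epsilon> by (intro divide_right_mono) auto
    then have "x * (g x)\<^sup>2 \<le> (x + \<epsilon> * L x) / ?d\<^sup>2" by (simp add: g_def power_divide)
    finally show ?thesis .
  qed
  define I' where "I' = circle_integral (\<lambda>\<tau>. 2 * J \<tau> * (g (q \<tau>) + q \<tau> * g' (q \<tau>)))"
  have DI: "(flux g has_real_derivative I' t) (at t)" if "t < T0" for t
    unfolding I'_def by (rule DERIV_flux[OF Dg cg' that])
  \<comment> \<open>the distortion inequality turns the growth of the flux into a weighted energy on the circle\<close>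
  have energy: "circle_integral (\<lambda>\<tau>. q \<tau> * (g (q \<tau>))\<^sup>2 * (cmod (Uth \<tau>))\<^sup>2) t \<le> K / 2 * I' t" if t: "t < T0" for t
  proof -
    have "circle_integral (\<lambda>\<tau>. q \<tau> * (g (q \<tau>))\<^sup>2 * (cmod (Uth \<tau>))\<^sup>2) t
        \<le> circle_integral (\<lambda>\<tau>. K / 2 * (2 * J \<tau> * (g (q \<tau>) + q \<tau> * g' (q \<tau>)))) t"
    proof (rule circle_integral_mono[OF _ _ t])
      fix \<theta>
      let ?\<tau> = "Complex t \<theta>"
      have H: "?\<tau> \<in> H" using t by simp
      have "q ?\<tau> * (g (q ?\<tau>))\<^sup>2 * (cmod (Uth ?\<tau>))\<^sup>2 \<le> (g (q ?\<tau>) + q ?\<tau> * g' (q ?\<tau>)) * (K * J ?\<tau>)"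
      proof (rule mult_mono)
        show le: "q ?\<tau> * (g (q ?\<tau>))\<^sup>2 \<le> g (q ?\<tau>) + q ?\<tau> * g' (q ?\<tau>)"
          using G' small[OF H] by simp
        show "0 \<le> g (q ?\<tau>) + q ?\<tau> * g' (q ?\<tau>)"
          by (rule order_trans[OF _ le]) simp
      qed (use distortion(2)[OF H] in auto)
      then show "q ?\<tau> * (g (q ?\<tau>))\<^sup>2 * (cmod (Uth ?\<tau>))\<^sup>2 \<le> K / 2 * (2 * J ?\<tau> * (g (q ?\<tau>) + q ?\<tau> * g' (q ?\<tau>)))"
        by (simp add: mult_ac)
    qed (intro continuous_intros C)+
    also have "\<dots> = K / 2 * I' t" unfolding I'_def by (rule circle_integral_cmult)
    finally show ?thesis .
  qed
  have product_bound: "(Im (cnj u * v))\<^sup>2 \<le> (cmod u)\<^sup>2 * (cmod v)\<^sup>2" "(Re (cnj u * v))\<^sup>2 \<le> (cmod u)\<^sup>2 * (cmod v)\<^sup>2" for u v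
    using power_mono[OF abs_Im_le_cmod abs_ge_zero, of "cnj u * v" 2] power_mono[OF abs_Re_le_cmod abs_ge_zero, of "cnj u * v" 2]
    by (simp_all only: power2_abs norm_mult power_mult_distrib complex_mod_cnj)
  have riccati: "1 / (pi * K) * (flux g t)\<^sup>2 \<le> I' t" if t: "t < T0" for t
  proof -
    have "(flux g t)\<^sup>2 \<le> (2 * pi - 0) * circle_integral (\<lambda>\<tau>. (g (q \<tau>) * X \<tau>)\<^sup>2) t"
      unfolding flux_def circle_integral_def
      by (intro square_integral_le circle_cont[OF _ t] continuous_intros C) auto
    also have "\<dots> \<le> (2 * pi - 0) * circle_integral (\<lambda>\<tau>. q \<tau> * (g (q \<tau>))\<^sup>2 * (cmod (Uth \<tau>))\<^sup>2) t"
    proof (intro mult_left_mono circle_integral_mono[OF _ _ t])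
      fix \<theta>
      let ?\<tau> = "Complex t \<theta>"
      show "(g (q ?\<tau>) * X ?\<tau>)\<^sup>2 \<le> q ?\<tau> * (g (q ?\<tau>))\<^sup>2 * (cmod (Uth ?\<tau>))\<^sup>2"
        using mult_left_mono[OF product_bound(1)[of "U ?\<tau>" "Uth ?\<tau>"] zero_le_power2[of "g (q ?\<tau>)"]]
        unfolding power_mult_distrib q_def by (simp only: mult_ac)
    qed (use pi_gt_zero in \<open>auto intro!: continuous_intros C\<close>)
    also have "\<dots> \<le> (2 * pi - 0) * (K / 2 * I' t)"
      using energy[OF t] by (intro mult_left_mono) auto
    finally show ?thesis using K by (simp add: field_simps)
  qed
  have osc: "(M - a)\<^sup>2 / (4 * pi * K) \<le> I' t" if t: "t0 - \<eta> \<le> t" "t \<le> t0" for t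
  proof -
    have tT: "t < T0" using t t0 by simp
    obtain \<theta>1 where \<theta>1: "\<theta>1 \<in> {0..2*pi}" "U (Complex t \<theta>1) = 0" using zero[OF tT] by blast
    have q_in: "q (Complex t \<theta>) \<in> {0..1/16}" for \<theta> using small tT by simp
    have Dhq: "((\<lambda>\<theta>. h (q (Complex t \<theta>))) has_real_derivative
        - g (q (Complex t \<theta>)) * (2 * Re (cnj (U (Complex t \<theta>)) * Uth (Complex t \<theta>)))) (at \<theta>)" for \<theta>
      by (rule DERIV_chain2[OF Dh[OF q_in] q_along_theta[OF tT]])
    have h0: "h (q (Complex t \<theta>1)) = M" using \<theta>1 \<epsilon> by (simp add: h_def L_def q_def)
    have "h (q (Complex t \<theta>0)) \<le> a"
    proof -
      have "ln c0 \<le> ln (q (Complex t \<theta>0) + \<epsilon>)" using \<eta>(2)[OF t] c0 \<epsilon> by simp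
      then have "L (q (Complex t \<theta>0)) \<le> - ln c0" by (simp add: L_def)
      then show ?thesis unfolding h_def a_def using xe(3)[OF q_in[of \<theta>0]] by simp
    qed
    then have "(M - a)\<^sup>2 \<le> (h (q (Complex t \<theta>1)) - h (q (Complex t \<theta>0)))\<^sup>2"
      unfolding h0 using Ma by (intro power_mono) auto
    also have "\<dots> \<le> (2 * pi - 0) * circle_integral (\<lambda>\<tau>. (- g (q \<tau>) * (2 * Re (cnj (U \<tau>) * Uth \<tau>)))\<^sup>2) t"
      unfolding circle_integral_def
      by (rule square_increment_le[OF Dhq _ \<theta>1(1) \<theta>0])
         (intro circle_cont[OF _ tT, where F = "\<lambda>\<tau>. - g (q \<tau>) * (2 * Re (cnj (U \<tau>) * Uth \<tau>))"] continuous_intros C)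
    also have "\<dots> \<le> (2 * pi - 0) * circle_integral (\<lambda>\<tau>. 4 * (q \<tau> * (g (q \<tau>))\<^sup>2 * (cmod (Uth \<tau>))\<^sup>2)) t"
    proof (intro mult_left_mono circle_integral_mono[OF _ _ tT])
      fix \<theta>
      let ?\<tau> = "Complex t \<theta>"
      show "(- g (q ?\<tau>) * (2 * Re (cnj (U ?\<tau>) * Uth ?\<tau>)))\<^sup>2 \<le> 4 * (q ?\<tau> * (g (q ?\<tau>))\<^sup>2 * (cmod (Uth ?\<tau>))\<^sup>2)"
        using mult_left_mono[OF product_bound(2)[of "U ?\<tau>" "Uth ?\<tau>"] zero_le_power2[of "g (q ?\<tau>)"]]
        unfolding power_mult_distrib q_def power2_minus by (simp only: mult_ac) simp
    qed (use pi_gt_zero in \<open>auto intro!: continuous_intros C\<close>)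
    also have "\<dots> \<le> (2 * pi - 0) * (4 * (K / 2 * I' t))"
      unfolding circle_integral_cmult using energy[OF tT] by (intro mult_left_mono) auto
    finally show ?thesis using K by (simp add: field_simps)
  qed
  have up: "flux g t0 \<le> bd"
    using Riccati_bound[OF T'(1), of "1 / (pi * K)" "flux g" I'] DI riccati T'(2) K by (simp add: bd_def field_simps)
  have "flux g (t0 - \<eta>) - (M - a)\<^sup>2 / (4 * pi * K) * (t0 - \<eta>) \<le> flux g t0 - (M - a)\<^sup>2 / (4 * pi * K) * t0"
  proof (rule DERIV_nonneg_imp_nondecreasing[where f = "\<lambda>t. flux g t - (M - a)\<^sup>2 / (4 * pi * K) * t"])
    fix x assume x: "t0 - \<eta> \<le> x" "x \<le> t0"
    have "((\<lambda>t. flux g t - (M - a)\<^sup>2 / (4 * pi * K) * t) has_real_derivative I' x - (M - a)\<^sup>2 / (4 * pi * K)) (at x)"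
      using DI[of x] x t0 K by (auto intro!: derivative_eq_intros)
    then show "\<exists>y. ((\<lambda>t. flux g t - (M - a)\<^sup>2 / (4 * pi * K) * t) has_real_derivative y) (at x) \<and> 0 \<le> y"
      using osc[OF x] by (intro exI conjI) auto
  qed (use \<eta> in simp)
  moreover have "0 \<le> flux g (t0 - \<eta>)"
  proof (rule flux_mono_nonneg(2)[OF Dg cg'])
    show "0 \<le> g x + x * g' x" if "x \<in> {0..1/16}" for x
      by (rule order_trans[OF _ G'[OF that]]) (use that in simp)
  qed (use \<eta> t0 in auto)
  ultimately have "(M - a)\<^sup>2 / (4 * pi * K) * \<eta> \<le> bd" using up unfolding right_diff_distrib by linarith
  moreover have "bd < (M - a)\<^sup>2 / (4 * pi * K) * \<eta>"
  proof -
    have "4 * pi * K * (bd / \<eta> + 1) * 1 \<le> (M - a) * (M - a)" using Ma bd K \<eta> by (intro mult_mono) auto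
    then have "bd / \<eta> + 1 \<le> (M - a)\<^sup>2 / (4 * pi * K)"
      using K by (simp add: field_simps power2_eq_square)
    then have "(bd / \<eta> + 1) * \<eta> \<le> (M - a)\<^sup>2 / (4 * pi * K) * \<eta>" using \<eta> by (intro mult_right_mono) auto
    then show ?thesis using \<eta> by (simp add: algebra_simps)
  qed
  ultimately show False by simp
qed

text \<open>
  The order of vanishing of \<open>u\<close> at \<open>p\<close> is bounded by \<open>K * S\<close>, where \<open>S\<close> bounds the
  logarithmic derivative of \<open>U\<close> on a zero-free circle. Here the weight is
  \<open>g x = ln (1 + x / \<epsilon>) / (x + \<epsilon>)\<close>, for which \<open>x / (x + \<epsilon>)\<^sup>2\<close> is at most
  the derivative of \<open>x g(x)\<close>. On the zero-free circle the flux is at most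
  \<open>2 * pi * S * ln (1 / \<epsilon>)\<close>.

  The integral \<open>m t\<close> of \<open>ln (q + \<epsilon>) / 2\<close> over a circle changes with a rate that is
  controlled, by the distortion inequality and the inequality of the arithmetic and geometric mean,
  by a constant and the derivative of the flux. Over the time from \<open>t\<close> to \<open>T\<close> it therefore
  grows by at most \<open>pi * K * S * (T - t) + pi / 2 * ln (1 / \<epsilon>)\<close>. If \<open>q \<le> \<epsilon>\<close> on the
  circle at \<open>t\<close>, then it grows by about \<open>pi * ln (1 / \<epsilon>)\<close>. If \<open>U\<close> decays like
  \<open>exp (N * t)\<close>, then \<open>\<epsilon>\<close> can be taken of size \<open>exp (2 * N * t)\<close>, and the
  comparison fails for \<open>N > K * S\<close> and \<open>t\<close> near \<open>-\<infinity>\<close>.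
\<close>
lemma zero_free_circle_imp_not_flat:
  assumes T: "T < T0" and nz: "\<forall>\<theta>\<in>{0..2*pi}. U (Complex T \<theta>) \<noteq> 0"
    and flat: "\<And>N :: nat. \<exists>C t1. \<forall>\<tau>. Re \<tau> < t1 \<longrightarrow> cmod (U \<tau>) \<le> C * exp (real N * Re \<tau>)"
  shows False
proof -
  obtain c where c: "c > 0" "\<And>\<theta>. \<theta> \<in> {0..2*pi} \<Longrightarrow> c \<le> q (Complex T \<theta>)"
  proof -
    have ne: "{0..2*pi} \<noteq> {}" by simp
    obtain \<theta>m where "\<theta>m \<in> {0..2*pi}" "\<And>\<theta>. \<theta> \<in> {0..2*pi} \<Longrightarrow> q (Complex T \<theta>m) \<le> q (Complex T \<theta>)"
      using continuous_attains_inf[OF _ ne circle_cont[OF cont_q T]] by auto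
    then show thesis using nz that[of "q (Complex T \<theta>m)"] by (auto simp: q_def)
  qed
  obtain S where S: "S > 0" "\<And>\<theta>. \<theta> \<in> {0..2*pi} \<Longrightarrow> cmod (Uth (Complex T \<theta>)) \<le> S * cmod (U (Complex T \<theta>))"
  proof -
    have ne: "{0..2*pi} \<noteq> {}" by simp
    let ?R = "\<lambda>\<theta>. cmod (Uth (Complex T \<theta>)) / cmod (U (Complex T \<theta>))"
    have "continuous_on {0..2*pi} ?R"
      using nz by (intro continuous_intros circle_cont[OF _ T, of "\<lambda>\<tau>. cmod (Uth \<tau>)"] circle_cont[OF _ T, of "\<lambda>\<tau>. cmod (U \<tau>)"] cont) auto
    from continuous_attains_sup[OF compact_Icc ne this]
    obtain \<theta>m where m: "\<And>\<theta>. \<theta> \<in> {0..2*pi} \<Longrightarrow> ?R \<theta> \<le> ?R \<theta>m" by blast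
    show thesis
    proof (rule that[of "cmod (Uth (Complex T \<theta>m)) / cmod (U (Complex T \<theta>m)) + 1"])
      show "0 < cmod (Uth (Complex T \<theta>m)) / cmod (U (Complex T \<theta>m)) + 1" by (simp add: add_nonneg_pos)
      fix \<theta> assume \<theta>: "\<theta> \<in> {0..2*pi}"
      have "cmod (Uth (Complex T \<theta>)) / cmod (U (Complex T \<theta>)) \<le> cmod (Uth (Complex T \<theta>m)) / cmod (U (Complex T \<theta>m)) + 1"
        using m[OF \<theta>] by simp
      then show "cmod (Uth (Complex T \<theta>)) \<le> (cmod (Uth (Complex T \<theta>m)) / cmod (U (Complex T \<theta>m)) + 1) * cmod (U (Complex T \<theta>))"
        using nz \<theta> by (simp add: divide_le_eq)
    qed
  qed
  obtain N :: nat where N: "real N > K * S" using reals_Archimedean2 by blast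
  obtain C0 t1 where C0: "\<And>\<tau>. Re \<tau> < t1 \<Longrightarrow> cmod (U \<tau>) \<le> C0 * exp (real N * Re \<tau>)"
    using flat[of N] by blast
  define C where "C = \<bar>C0\<bar> + 1"
  have C: "C > 0" "\<And>\<tau>. Re \<tau> < t1 \<Longrightarrow> cmod (U \<tau>) \<le> C * exp (real N * Re \<tau>)"
  proof -
    show "C > 0" by (simp add: C_def)
    show "cmod (U \<tau>) \<le> C * exp (real N * Re \<tau>)" if "Re \<tau> < t1" for \<tau>
      by (rule order_trans[OF C0[OF that]]) (auto simp: C_def intro!: mult_right_mono)
  qed
  have Npos: "real N > 0" using N mult_pos_pos[OF K S(1)] by linarith
  \<comment> \<open>\<open>const\<close> collects what is independent of \<open>t\<close> in the final comparison. The bound for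
    \<open>real N * t\<close> makes \<open>\<epsilon>\<close> less than \<open>1/2\<close>, the one for \<open>(real N - K * S) * t\<close>
    contradicts the comparison.\<close>
  define const where "const = K * S * T - ln c + ln 2 + ln C"
  define t where "t = min (min (T - 1) (t1 - 1)) (min ((- 2 - ln C) / real N) ((- \<bar>const\<bar> - 1) / (real N - K * S)))"
  have t: "t < T" "t < t1" "real N * t \<le> - 2 - ln C" "(real N - K * S) * t \<le> - \<bar>const\<bar> - 1"
  proof -
    have "t \<le> (- 2 - ln C) / real N" "t \<le> (- \<bar>const\<bar> - 1) / (real N - K * S)" by (simp_all add: t_def)
    then show "real N * t \<le> - 2 - ln C" "(real N - K * S) * t \<le> - \<bar>const\<bar> - 1"
      using N Npos by (simp_all add: pos_le_divide_eq mult.commute)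
  qed (auto simp: t_def)
  define \<epsilon> where "\<epsilon> = (C * exp (real N * t))\<^sup>2"
  have ln\<epsilon>: "ln \<epsilon> = 2 * (ln C + real N * t)"
    using C by (simp add: \<epsilon>_def ln_mult ln_realpow)
  have \<epsilon>: "\<epsilon> > 0" "\<epsilon> < 1/2"
  proof -
    show 0: "\<epsilon> > 0" using C by (simp add: \<epsilon>_def)
    have "ln \<epsilon> \<le> - 4" unfolding ln\<epsilon> using t(3) by simp
    then have "\<epsilon> \<le> exp (-4)" using 0 by (metis exp_ln exp_le_cancel_iff)
    also have "exp (-4::real) < 1/2" using exp_ge_add_one_self[of "4::real"] by (simp add: exp_minus field_simps)
    finally show "\<epsilon> < 1/2" .
  qed
  define \<Lambda> where "\<Lambda> x = ln (x + \<epsilon>) - ln \<epsilon>" for x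
  define g where "g x = \<Lambda> x / (x + \<epsilon>)" for x
  define g' where "g' x = (1 - \<Lambda> x) / (x + \<epsilon>)\<^sup>2" for x
  have xe: "0 < x + \<epsilon>" "x + \<epsilon> \<le> 1" "0 \<le> \<Lambda> x" "\<Lambda> x \<le> - ln \<epsilon>" if "x \<in> {0..1/16}" for x
  proof -
    show 1: "0 < x + \<epsilon>" "x + \<epsilon> \<le> 1" using that \<epsilon> by auto
    show "0 \<le> \<Lambda> x" using that \<epsilon> by (simp add: \<Lambda>_def)
    show "\<Lambda> x \<le> - ln \<epsilon>" using 1 by (simp add: \<Lambda>_def)
  qed
  have D\<Lambda>: "(\<Lambda> has_real_derivative 1 / (x + \<epsilon>)) (at x)" if "x \<in> {0..1/16}" for x
    unfolding \<Lambda>_def using xe(1)[OF that] by (auto intro!: derivative_eq_intros)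
  have Dg: "(g has_real_derivative g' x) (at x)" if "x \<in> {0..1/16}" for x
    unfolding g_def g'_def using xe(1)[OF that]
    by (auto intro!: derivative_eq_intros D\<Lambda>[OF that] simp: power2_eq_square)
  have c\<Lambda>: "continuous_on {0..1/16} \<Lambda>"
    using D\<Lambda> DERIV_isCont by (blast intro: continuous_at_imp_continuous_on)
  have cg: "continuous_on {0..1/16} g"
    using Dg DERIV_isCont by (blast intro: continuous_at_imp_continuous_on)
  have cg': "continuous_on {0..1/16} g'"
    unfolding g'_def using xe by (intro continuous_intros c\<Lambda>) force
  have G': "x / (x + \<epsilon>)\<^sup>2 \<le> g x + x * g' x" if "x \<in> {0..1/16}" for x
  proof -
    note xe = xe[OF that]
    have "g x + x * g' x = (\<Lambda> x * (x + \<epsilon>) + x * (1 - \<Lambda> x)) / (x + \<epsilon>)\<^sup>2"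
    proof -
      have "A / y + x * (B / y\<^sup>2) = (A * y + x * B) / y\<^sup>2" if "y \<noteq> 0" for y A B :: real
        using that by (simp add: add_divide_distrib power2_eq_square)
      from this[of "x + \<epsilon>"] show ?thesis using xe by (simp add: g_def g'_def)
    qed
    also have "\<Lambda> x * (x + \<epsilon>) + x * (1 - \<Lambda> x) = x + \<epsilon> * \<Lambda> x" by (simp add: algebra_simps)
    also have "x / (x + \<epsilon>)\<^sup>2 \<le> (x + \<epsilon> * \<Lambda> x) / (x + \<epsilon>)\<^sup>2"
      using xe \<epsilon> by (intro divide_right_mono) auto
    finally show ?thesis .
  qed
  have G'pos: "0 \<le> g x + x * g' x" if "x \<in> {0..1/16}" for x
    using order_trans[OF _ G'[OF that]] that by simp
  have ce: "continuous_on {0..1/16} (\<lambda>x. 1 / (x + \<epsilon>))" "continuous_on {0..1/16} (\<lambda>x. ln (x + \<epsilon>))"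
    using xe by (auto intro!: continuous_intros simp: less_imp_neq[symmetric])
  note C' = cont cont_q cont_J cont_comp_q[OF cg] cont_comp_q[OF cg'] cont_comp_q[OF ce(1)] cont_comp_q[OF ce(2)]
  define I' where "I' = circle_integral (\<lambda>\<tau>. 2 * J \<tau> * (g (q \<tau>) + q \<tau> * g' (q \<tau>)))"
  have DI: "(flux g has_real_derivative I' t) (at t)" if "t < T0" for t
    unfolding I'_def by (rule DERIV_flux[OF Dg cg' that])
  define m where "m = circle_integral (\<lambda>\<tau>. 1/2 * ln (q \<tau> + \<epsilon>))"
  define m' where "m' = circle_integral (\<lambda>\<tau>. 1 / (q \<tau> + \<epsilon>) * Re (cnj (U \<tau>) * Ut \<tau>))"
  have Dm: "(m has_real_derivative m' t) (at t)" if t: "t < T0" for t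
    unfolding m_def m'_def
  proof (rule DERIV_circle_integral[OF _ _ t])
    fix t \<theta> assume t: "t < T0"
    have "q (Complex t \<theta>) + \<epsilon> > 0" using \<epsilon> by (simp add: add_nonneg_pos)
    then show "((\<lambda>t. 1/2 * ln (q (Complex t \<theta>) + \<epsilon>)) has_real_derivative
        1 / (q (Complex t \<theta>) + \<epsilon>) * Re (cnj (U (Complex t \<theta>)) * Ut (Complex t \<theta>))) (at t)"
      by (auto intro!: derivative_eq_intros q_along_t[OF t] simp: field_simps)
  qed (intro continuous_intros C')+
  \<comment> \<open>with this weight in the inequality of the two means the flux at \<open>T\<close> costs exactly half of
    \<open>pi * ln (1 / \<epsilon>)\<close>\<close>
  define \<mu> where "\<mu> = K * S / 2"
  have \<mu>: "\<mu> > 0" using K S by (simp add: \<mu>_def)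
  have m'_le: "m' t \<le> 2 * pi * \<mu> + K / (8 * \<mu>) * I' t" if t: "t < T0" for t
  proof -
    have "m' t \<le> circle_integral (\<lambda>\<tau>. \<mu> + K / (8 * \<mu>) * (2 * J \<tau> * (g (q \<tau>) + q \<tau> * g' (q \<tau>)))) t"
      unfolding m'_def
    proof (rule circle_integral_mono[OF _ _ t])
      fix \<theta>
      let ?\<tau> = "Complex t \<theta>"
      let ?r = "1 / (q ?\<tau> + \<epsilon>) * Re (cnj (U ?\<tau>) * Ut ?\<tau>)"
      have H: "?\<tau> \<in> H" using t by simp
      have qe: "q ?\<tau> + \<epsilon> > 0" using \<epsilon> by (simp add: add_nonneg_pos)
      have "(Re (cnj (U ?\<tau>) * Ut ?\<tau>))\<^sup>2 \<le> (cmod (cnj (U ?\<tau>) * Ut ?\<tau>))\<^sup>2"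
        using power_mono[OF abs_Re_le_cmod abs_ge_zero, of "cnj (U ?\<tau>) * Ut ?\<tau>" 2] by (simp only: power2_abs)
      also have "\<dots> = q ?\<tau> * (cmod (Ut ?\<tau>))\<^sup>2"
        by (simp only: norm_mult power_mult_distrib complex_mod_cnj q_def)
      also have "\<dots> \<le> q ?\<tau> * (K * J ?\<tau>)" by (intro mult_left_mono distortion H q_nonneg)
      finally have "(Re (cnj (U ?\<tau>) * Ut ?\<tau>))\<^sup>2 / (q ?\<tau> + \<epsilon>)\<^sup>2 \<le> q ?\<tau> * (K * J ?\<tau>) / (q ?\<tau> + \<epsilon>)\<^sup>2"
        by (rule divide_right_mono) simp
      moreover have "?r\<^sup>2 = (Re (cnj (U ?\<tau>) * Ut ?\<tau>))\<^sup>2 / (q ?\<tau> + \<epsilon>)\<^sup>2"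
        by (simp only: power_mult_distrib power_divide) simp
      ultimately have "?r\<^sup>2 \<le> q ?\<tau> / (q ?\<tau> + \<epsilon>)\<^sup>2 * (K * J ?\<tau>)" by simp
      also have "\<dots> \<le> (g (q ?\<tau>) + q ?\<tau> * g' (q ?\<tau>)) * (K * J ?\<tau>)"
        using G'[of "q ?\<tau>"] small[OF H] J_nonneg[OF H] K by (intro mult_right_mono) auto
      finally have r2: "?r\<^sup>2 \<le> K * (J ?\<tau> * (g (q ?\<tau>) + q ?\<tau> * g' (q ?\<tau>)))" by (simp add: mult_ac)
      have "r \<le> \<mu> + r\<^sup>2 / (4 * \<mu>)" for r
      proof -
        have "0 \<le> (r - 2 * \<mu>)\<^sup>2" by simp
        then show ?thesis using \<mu> unfolding power2_diff by (simp add: field_simps power2_eq_square)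
      qed
      then have "?r \<le> \<mu> + ?r\<^sup>2 / (4 * \<mu>)" .
      also have "?r\<^sup>2 / (4 * \<mu>) \<le> K * (J ?\<tau> * (g (q ?\<tau>) + q ?\<tau> * g' (q ?\<tau>))) / (4 * \<mu>)"
        using r2 \<mu> by (intro divide_right_mono) auto
      finally show "?r \<le> \<mu> + K / (8 * \<mu>) * (2 * J ?\<tau> * (g (q ?\<tau>) + q ?\<tau> * g' (q ?\<tau>)))"
        by (simp add: mult_ac)
    qed (intro continuous_intros C')+
    also have "\<dots> = circle_integral (\<lambda>\<tau>. \<mu>) t + circle_integral (\<lambda>\<tau>. K / (8 * \<mu>) * (2 * J \<tau> * (g (q \<tau>) + q \<tau> * g' (q \<tau>)))) t"
      by (rule circle_integral_add[OF _ _ t]) (intro continuous_intros C')+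
    finally show ?thesis unfolding circle_integral_const circle_integral_cmult I'_def .
  qed
  have main: "m T - 2 * pi * \<mu> * T - K / (8 * \<mu>) * flux g T \<le> m t - 2 * pi * \<mu> * t - K / (8 * \<mu>) * flux g t"
  proof (rule DERIV_nonpos_imp_nonincreasing[where f = "\<lambda>t. m t - 2 * pi * \<mu> * t - K / (8 * \<mu>) * flux g t"])
    fix x assume "t \<le> x" "x \<le> T"
    then have x: "x < T0" using T by simp
    have "((\<lambda>t. m t - 2 * pi * \<mu> * t - K / (8 * \<mu>) * flux g t) has_real_derivative
        m' x - 2 * pi * \<mu> - K / (8 * \<mu>) * I' x) (at x)"
      using \<mu> by (auto intro!: derivative_eq_intros Dm[OF x] DI[OF x])
    then show "\<exists>y. ((\<lambda>t. m t - 2 * pi * \<mu> * t - K / (8 * \<mu>) * flux g t) has_real_derivative y) (at x) \<and> y \<le> 0"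
      using m'_le[OF x] by (intro exI conjI) auto
  qed (use t in simp)
  have flux_t: "0 \<le> flux g t" by (rule flux_mono_nonneg(2)[OF Dg cg' G'pos]) (use t T in auto)
  have flux_T: "flux g T \<le> 2 * pi * (S * - ln \<epsilon>)"
  proof -
    have "flux g T \<le> circle_integral (\<lambda>\<tau>. S * - ln \<epsilon>) T"
      unfolding flux_def
    proof (rule circle_integral_mono[OF _ _ T])
      fix \<theta> assume \<theta>: "\<theta> \<in> {0..2*pi}"
      let ?\<tau> = "Complex T \<theta>"
      have qi: "q ?\<tau> \<in> {0..1/16}" using small[of ?\<tau>] T by simp
      note xe = xe[OF qi]
      have "X ?\<tau> \<le> cmod (cnj (U ?\<tau>) * Uth ?\<tau>)" using abs_Im_le_cmod[of "cnj (U ?\<tau>) * Uth ?\<tau>"] by linarith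
      also have "\<dots> \<le> cmod (U ?\<tau>) * (S * cmod (U ?\<tau>))"
        using S(2)[OF \<theta>] by (simp only: norm_mult complex_mod_cnj) (intro mult_left_mono, auto)
      also have "\<dots> = S * q ?\<tau>" by (simp add: q_def power2_eq_square)
      finally have "g (q ?\<tau>) * X ?\<tau> \<le> g (q ?\<tau>) * (S * q ?\<tau>)"
        using xe by (intro mult_left_mono) (auto simp: g_def)
      also have "\<dots> = (\<Lambda> (q ?\<tau>) * S) * (q ?\<tau> / (q ?\<tau> + \<epsilon>))" by (simp add: g_def)
      also have "\<dots> \<le> (- ln \<epsilon> * S) * 1"
      proof (rule mult_mono)
        show "0 \<le> - ln \<epsilon> * S" using xe(3,4) S(1) by (intro mult_nonneg_nonneg) linarith+
        show "\<Lambda> (q ?\<tau>) * S \<le> - ln \<epsilon> * S" using xe(4) S(1) by (intro mult_right_mono) auto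
      qed (use xe \<epsilon> in \<open>auto simp: divide_le_eq\<close>)
      finally show "g (q ?\<tau>) * X ?\<tau> \<le> S * - ln \<epsilon>" by (simp add: mult_ac)
    qed (intro continuous_intros C')+
    then show ?thesis by (simp only: circle_integral_const)
  qed
  have m_T: "2 * pi * (1/2 * ln c) \<le> m T"
    unfolding m_def circle_integral_const[of _ T, symmetric]
  proof (rule circle_integral_mono[OF _ _ T])
    fix \<theta> assume "\<theta> \<in> {0..2*pi}"
    from c(2)[OF this] have "ln c \<le> ln (q (Complex T \<theta>) + \<epsilon>)"
      using c(1) \<epsilon> by simp
    then show "1/2 * ln c \<le> 1/2 * ln (q (Complex T \<theta>) + \<epsilon>)" by simp
  qed (intro continuous_intros C')+
  have m_t: "m t \<le> 2 * pi * (1/2 * ln (2 * \<epsilon>))"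
    unfolding m_def circle_integral_const[of _ t, symmetric]
  proof (rule circle_integral_mono[OF _ _ less_trans[OF t(1) T]])
    fix \<theta>
    have "cmod (U (Complex t \<theta>)) \<le> C * exp (real N * t)" using C(2)[of "Complex t \<theta>"] t by simp
    then have "q (Complex t \<theta>) \<le> \<epsilon>" unfolding q_def \<epsilon>_def by (intro power_mono) auto
    moreover have "0 < q (Complex t \<theta>) + \<epsilon>" using \<epsilon> by (simp add: add_nonneg_pos)
    ultimately have "ln (q (Complex t \<theta>) + \<epsilon>) \<le> ln (2 * \<epsilon>)"
      using \<epsilon> by (intro ln_le_cancel_iff[THEN iffD2]) auto
    then show "1/2 * ln (q (Complex t \<theta>) + \<epsilon>) \<le> 1/2 * ln (2 * \<epsilon>)" by simp
  qed (intro continuous_intros C')+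
  have k: "K / (8 * \<mu>) * (2 * pi * (S * - ln \<epsilon>)) = pi * (- ln \<epsilon> / 2)"
    using K S by (simp add: \<mu>_def field_simps)
  have "K / (8 * \<mu>) * flux g T \<le> pi * (- ln \<epsilon> / 2)" unfolding k[symmetric]
    using flux_T K \<mu> by (intro mult_left_mono) auto
  moreover have "0 \<le> K / (8 * \<mu>) * flux g t" using flux_t K \<mu> by simp
  ultimately have "pi * ln c - 2 * pi * \<mu> * T - pi * (- ln \<epsilon> / 2) \<le> pi * ln (2 * \<epsilon>) - 2 * pi * \<mu> * t"
    using main m_T m_t by simp
  then have "pi * (ln c - K * S * T - (- ln \<epsilon> / 2)) \<le> pi * (ln (2 * \<epsilon>) - K * S * t)"
    by (simp add: \<mu>_def algebra_simps)
  then have "ln c - K * S * T - (- ln \<epsilon> / 2) \<le> ln (2 * \<epsilon>) - K * S * t" by simp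
  moreover have "ln (2 * \<epsilon>) = ln 2 + ln \<epsilon>" using \<epsilon> by (simp add: ln_mult)
  ultimately have "- const \<le> real N * t - K * S * t"
    unfolding ln\<epsilon> const_def by argo
  then show False using t(4) unfolding left_diff_distrib by linarith
qed

lemma flat_imp_zero:
  assumes flat: "\<And>N :: nat. \<exists>C t1. \<forall>\<tau>. Re \<tau> < t1 \<longrightarrow> cmod (U \<tau>) \<le> C * exp (real N * Re \<tau>)"
    and "t < T0" "\<theta> \<in> {0..2*pi}"
  shows "U (Complex t \<theta>) = 0"
  using exists_zero_free_circle[OF assms(2,3)] zero_free_circle_imp_not_flat[OF _ _ flat] by blast

end

text \<open>
  Strong unique continuation for quasiregular maps. If \<open>u\<close> had a point near \<open>p\<close> where it
  does not vanish, some circle around \<open>p\<close> would be free of zeros, and this bounds the order of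
  vanishing at \<open>p\<close>.
\<close>
lemma quasiregular_flat_imp_zero:
  assumes S: "open S" "cball p R \<subseteq> S" "R > 0" and u: "smooth_on S u"
    and small: "\<And>x. x \<in> ball p R \<Longrightarrow> cmod (u x) \<le> 1/4"
    and k: "0 \<le> k" "k < 1" and qr: "\<And>x. x \<in> ball p R \<Longrightarrow> cmod (dzbar u x) \<le> k * cmod (dz u x)"
    and flat: "\<And>N :: nat. \<exists>C r. 0 < r \<and> (\<forall>x\<in>ball p r. cmod (u x) \<le> C * cmod (x - p) ^ N)"
    and x: "x \<in> ball p R"
  shows "u x = 0"
proof -
  define U where "U = (\<lambda>\<tau>. u (p + exp \<tau>))"
  let ?H = "{\<tau>. Re \<tau> < ln R}"
  let ?Ut = "\<lambda>\<tau>. frechet_derivative U (at \<tau>) 1" and ?Uth = "\<lambda>\<tau>. frechet_derivative U (at \<tau>) \<i>"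
  define K where "K = (1 + k) / (1 - k)"
  have K: "K > 0" using k by (simp add: K_def)
  have in_ball: "p + exp \<tau> \<in> ball p R" if "\<tau> \<in> ?H" for \<tau>
  proof -
    have "exp (Re \<tau>) < exp (ln R)" using that by (simp del: exp_ln)
    then show ?thesis using S(3) by (simp add: dist_norm)
  qed
  have H: "open ?H" by (simp add: open_halfspace_Re_lt)
  have ballS: "ball p R \<subseteq> S" using S(2) ball_subset_cball by blast
  have smoothU: "smooth_on ?H U"
    unfolding U_def
    by (rule smooth_on_compose[OF H smooth_on_subset[OF u ballS]])
       (use in_ball in \<open>auto intro!: smooth_on_add[OF H] smooth_on_const smooth_on_subset[OF smooth_on_exp]\<close>)
  have D: "frechet_derivative U (at \<tau>) v = dz u (p + exp \<tau>) * exp \<tau> * v + dzbar u (p + exp \<tau>) * cnj (exp \<tau>) * cnj v"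
    if \<tau>: "\<tau> \<in> ?H" for \<tau> v
  proof -
    have "((\<lambda>\<tau>. p + exp \<tau>) has_derivative (\<lambda>v. exp \<tau> * v)) (at \<tau>)"
      using DERIV_exp[of \<tau>] by (auto intro!: derivative_eq_intros simp: has_field_derivative_def)
    moreover have "u differentiable (at (p + exp \<tau>))"
      using smooth_on_differentiable[OF u] in_ball[OF \<tau>] ballS by blast
    ultimately have "(U has_derivative (\<lambda>v. dz u (p + exp \<tau>) * (exp \<tau> * v) + dzbar u (p + exp \<tau>) * cnj (exp \<tau> * v))) (at \<tau>)"
      unfolding U_def using has_derivative_compose has_derivative_Wirtinger by blast
    from frechet_derivative_at[OF this, symmetric] show ?thesis by (simp add: mult.assoc)
  qed
  have dist1: "(cmod (?Ut \<tau>))\<^sup>2 \<le> K * Im (cnj (?Ut \<tau>) * ?Uth \<tau>)"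
    and dist2: "(cmod (?Uth \<tau>))\<^sup>2 \<le> K * Im (cnj (?Ut \<tau>) * ?Uth \<tau>)" if \<tau>: "\<tau> \<in> ?H" for \<tau>
  proof -
    define \<alpha> \<beta> where "\<alpha> = dz u (p + exp \<tau>) * exp \<tau>" and "\<beta> = dzbar u (p + exp \<tau>) * cnj (exp \<tau>)"
    have U1: "?Ut \<tau> = \<alpha> + \<beta>" and U2: "?Uth \<tau> = \<i> * (\<alpha> - \<beta>)"
      using D[OF \<tau>] by (simp_all add: \<alpha>_def \<beta>_def algebra_simps)
    have J: "Im (cnj (?Ut \<tau>) * ?Uth \<tau>) = (cmod \<alpha>)\<^sup>2 - (cmod \<beta>)\<^sup>2"
      unfolding U1 U2 cmod_power2 by (simp add: algebra_simps power2_eq_square)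
    have \<beta>: "cmod \<beta> \<le> k * cmod \<alpha>"
      using mult_right_mono[OF qr[OF in_ball[OF \<tau>]], of "cmod (exp \<tau>)"]
      unfolding \<alpha>_def \<beta>_def norm_mult complex_mod_cnj by (simp add: mult_ac)
    have "(cmod \<alpha> + cmod \<beta>) * (1 - k) \<le> (1 + k) * (cmod \<alpha> - cmod \<beta>)"
      using \<beta> by (simp add: algebra_simps)
    then have "cmod \<alpha> + cmod \<beta> \<le> K * (cmod \<alpha> - cmod \<beta>)"
      using k by (simp add: K_def pos_le_divide_eq)
    then have "(cmod \<alpha> + cmod \<beta>) * (cmod \<alpha> + cmod \<beta>) \<le> (K * (cmod \<alpha> - cmod \<beta>)) * (cmod \<alpha> + cmod \<beta>)"
      by (rule mult_right_mono) simp
    then have le: "(cmod \<alpha> + cmod \<beta>)\<^sup>2 \<le> K * ((cmod \<alpha>)\<^sup>2 - (cmod \<beta>)\<^sup>2)"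
      by (simp add: power2_eq_square algebra_simps)
    show "(cmod (?Ut \<tau>))\<^sup>2 \<le> K * Im (cnj (?Ut \<tau>) * ?Uth \<tau>)"
      unfolding J unfolding U1 by (rule order_trans[OF power_mono[OF norm_triangle_ineq] le]) simp
    show "(cmod (?Uth \<tau>))\<^sup>2 \<le> K * Im (cnj (?Ut \<tau>) * ?Uth \<tau>)"
      unfolding J unfolding U2 norm_mult using order_trans[OF power_mono[OF norm_triangle_ineq4[of \<alpha> \<beta>], of 2] le] by simp
  qed
  have decay: "\<exists>B. \<forall>\<tau>\<in>?H. cmod (?Uth \<tau>) \<le> B * exp (Re \<tau>)"
  proof -
    have "compact ((\<lambda>x. cmod (dz u x) + cmod (dzbar u x)) ` cball p R)"
      using continuous_on_subset[OF smooth_on_continuous[OF smooth_on_dz[OF S(1) u]] S(2)]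
        continuous_on_subset[OF smooth_on_continuous[OF smooth_on_dzbar[OF S(1) u]] S(2)]
      by (intro compact_continuous_image continuous_intros) auto
    then obtain B where "\<forall>y\<in>(\<lambda>x. cmod (dz u x) + cmod (dzbar u x)) ` cball p R. norm y \<le> B"
      using compact_imp_bounded bounded_iff by blast
    then have B: "cmod (dz u x) + cmod (dzbar u x) \<le> B" if "x \<in> cball p R" for x using that by force
    have "cmod (?Uth \<tau>) \<le> B * exp (Re \<tau>)" if \<tau>: "\<tau> \<in> ?H" for \<tau>
    proof -
      have "cmod (?Uth \<tau>) \<le> (cmod (dz u (p + exp \<tau>)) + cmod (dzbar u (p + exp \<tau>))) * exp (Re \<tau>)"
        unfolding D[OF \<tau>] by (rule order_trans[OF norm_triangle_ineq]) (simp add: norm_mult algebra_simps)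
      also have "\<dots> \<le> B * exp (Re \<tau>)"
        using B[of "p + exp \<tau>"] in_ball[OF \<tau>] ball_subset_cball by (intro mult_right_mono) auto
      finally show ?thesis .
    qed
    then show ?thesis by blast
  qed
  have per: "U (\<tau> + 2 * of_real pi * \<i>) = U \<tau>" for \<tau>
    by (simp add: U_def exp_add exp_two_pi_i)
  have sm: "(cmod (U \<tau>))\<^sup>2 \<le> 1/16" if "\<tau> \<in> ?H" for \<tau>
    using power_mono[OF small[OF in_ball[OF that]], of 2] by (simp add: U_def power2_eq_square)
  interpret quasiregular_cylinder U ?Ut ?Uth "ln R" K ?H "\<lambda>\<tau>. (cmod (U \<tau>))\<^sup>2" "\<lambda>\<tau>. Im (cnj (?Ut \<tau>) * ?Uth \<tau>)"
    by unfold_locales (use smoothU per sm K dist1 dist2 decay in auto)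
  have flatU: "\<exists>C t1. \<forall>\<tau>. Re \<tau> < t1 \<longrightarrow> cmod (U \<tau>) \<le> C * exp (real N * Re \<tau>)" for N :: nat
  proof -
    obtain C r where r: "0 < r" and C: "\<And>x. x \<in> ball p r \<Longrightarrow> cmod (u x) \<le> C * cmod (x - p) ^ N"
      using flat[of N] by blast
    have "cmod (U \<tau>) \<le> C * exp (real N * Re \<tau>)" if "Re \<tau> < ln r" for \<tau>
    proof -
      have "exp (Re \<tau>) < exp (ln r)" using that by (simp del: exp_ln)
      then have "p + exp \<tau> \<in> ball p r" using r by (simp add: dist_norm)
      from C[OF this] show ?thesis by (simp add: U_def exp_of_nat_mult)
    qed
    then show ?thesis by blast
  qed
  show ?thesis
  proof (cases "x = p")
    case True
    obtain C r where "0 < r" and C: "\<And>x. x \<in> ball p r \<Longrightarrow> cmod (u x) \<le> C * cmod (x - p) ^ 1"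
      using flat[of 1] by blast
    then show ?thesis using C[of p] True by simp
  next
    case False
    define t where "t = ln (cmod (x - p))"
    have "cmod (x - p) < R" using x by (simp add: dist_norm norm_minus_commute)
    then have t: "t < ln R" unfolding t_def using False S(3) by (intro ln_less_cancel_iff[THEN iffD2]) auto
    have "exp (Complex t (Arg2pi (x - p))) = of_real (cmod (x - p)) * exp (\<i> * of_real (Arg2pi (x - p)))"
      using False by (simp add: Complex_eq exp_add t_def exp_of_real)
    also have "\<dots> = x - p" using Arg2pi_eq[of "x - p"] by simp
    finally have "U (Complex t (Arg2pi (x - p))) = u x" by (simp add: U_def)
    moreover have "Arg2pi (x - p) \<in> {0..2*pi}" using Arg2pi[of "x - p"] by auto
    ultimately show ?thesis using flat_imp_zero[OF flatU t, of "Arg2pi (x - p)"] by simp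
  qed
qed

section \<open>Quasiconformal coordinates and ellipticity\<close>

lemma quasiconformal_homeo_ident:
  assumes "open U"
  shows "quasiconformal_homeo U (\<lambda>x. x)"
proof -
  have "homeomorphism U ((\<lambda>x. x) ` U) (\<lambda>x. x) (\<lambda>x. x)" by (simp add: homeomorphism_def)
  moreover have "dzbar (\<lambda>x. x) \<zeta> = 0 * dz (\<lambda>x. x) \<zeta>" for \<zeta>
    using Wirtinger_holomorphic(2)[OF DERIV_ident] by simp
  moreover have "Ck_on 1 U (\<lambda>x. x)" using Ck_on_ident[OF assms] .
  ultimately show ?thesis
    unfolding quasiconformal_homeo_def using assms
    by (intro conjI, simp, simp, blast, blast) (rule exI[of _ "\<lambda>_. 0"], rule exI[of _ 0], simp)
qed

text \<open>
  On a small ball \<open>F\<close> differs from its differential at \<open>p\<close> by a map with Lipschitz constant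
  \<open>m / 2\<close>, while the differential expands distances by at least \<open>m\<close>; hence \<open>F\<close> is injective
  there. The image is open by invariance of domain, and the Beltrami coefficient is bounded by
  continuity.
\<close>
lemma local_quasiconformal_homeo:
  assumes D: "open D" "p \<in> D" and F: "smooth_on D F" and less: "cmod (dzbar F p) < cmod (dz F p)"
  obtains U where "open U" "p \<in> U" "U \<subseteq> D" "quasiconformal_homeo U F"
proof -
  define m where "m = cmod (dz F p) - cmod (dzbar F p)"
  \<comment> \<open>\<open>\<rho>\<close> is the modulus of the Beltrami coefficient at \<open>p\<close>, and \<open>k\<close> lies between \<open>\<rho>\<close> and \<open>1\<close>\<close>
  define \<rho> where "\<rho> = cmod (dzbar F p) / cmod (dz F p)"
  define k where "k = (\<rho> + 1) / 2"
  have dz0: "cmod (dz F p) > 0" by (rule le_less_trans[OF norm_ge_zero less])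
  have "\<rho> < 1" using less dz0 by (simp add: \<rho>_def)
  then have k: "k < 1" "k > \<rho>" unfolding k_def by simp_all
  have kp: "cmod (dzbar F p) - k * cmod (dz F p) < 0"
    using k(2) dz0 by (simp add: \<rho>_def pos_divide_less_eq)
  have c: "isCont (dz F) p" "isCont (dzbar F) p"
    using smooth_on_continuous[OF smooth_on_dz[OF D(1) F]] smooth_on_continuous[OF smooth_on_dzbar[OF D(1) F]] D
    by (auto simp: continuous_on_eq_continuous_at)
  have "\<forall>\<^sub>F x in at p. cmod (dzbar F x) - k * cmod (dz F x) < 0"
    using c kp by (intro order_tendstoD(2)[of _ "cmod (dzbar F p) - k * cmod (dz F p)"]) (auto intro!: tendsto_intros simp: isCont_def)
  moreover have "\<forall>\<^sub>F x in at p. cmod (dz F x - dz F p) + cmod (dzbar F x - dzbar F p) < m / 2"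
  proof (rule order_tendstoD(2))
    show "((\<lambda>x. cmod (dz F x - dz F p) + cmod (dzbar F x - dzbar F p)) \<longlongrightarrow>
        cmod (dz F p - dz F p) + cmod (dzbar F p - dzbar F p)) (at p)"
      using c unfolding isCont_def by (intro tendsto_intros)
  qed (use less in \<open>simp add: m_def\<close>)
  moreover have "\<forall>\<^sub>F x in at p. x \<in> D" using D by (simp add: eventually_at_in_open')
  ultimately have "\<forall>\<^sub>F x in at p. cmod (dzbar F x) - k * cmod (dz F x) < 0 \<and>
      cmod (dz F x - dz F p) + cmod (dzbar F x - dzbar F p) < m / 2 \<and> x \<in> D" by eventually_elim blast
  then obtain r where r: "r > 0" and near: "\<And>x. x \<noteq> p \<Longrightarrow> dist x p < r \<Longrightarrow> cmod (dzbar F x) - k * cmod (dz F x) < 0 \<and>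
      cmod (dz F x - dz F p) + cmod (dzbar F x - dzbar F p) < m / 2 \<and> x \<in> D"
    unfolding eventually_at by blast
  have near': "cmod (dzbar F x) - k * cmod (dz F x) < 0"
      "cmod (dz F x - dz F p) + cmod (dzbar F x - dzbar F p) < m / 2" "x \<in> D" if "x \<in> ball p r" for x
    using near[of x] that kp less D by (cases "x = p"; simp add: dist_commute m_def)+
  let ?B = "ball p r"
  have sub: "?B \<subseteq> D" using near'(3) by blast
  let ?L = "\<lambda>v. dz F p * v + dzbar F p * cnj v"
  have Llow: "cmod (?L v) \<ge> m * cmod v" for v
    using norm_diff_ineq[of "dz F p * v" "dzbar F p * cnj v"] by (simp add: norm_mult m_def algebra_simps)
  have inj: "inj_on F ?B"
  proof (rule inj_onI, rule ccontr)
    fix x y assume xy: "x \<in> ?B" "y \<in> ?B" "F x = F y" "x \<noteq> y"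
    have "cmod ((F x - ?L x) - (F y - ?L y)) \<le> m / 2 * cmod (x - y)"
    proof (rule differentiable_bound[OF convex_ball _ _ xy(1,2),
          where f' = "\<lambda>w v. dz F w * v + dzbar F w * cnj v - ?L v"])
      fix w assume w: "w \<in> ?B"
      have "(?L has_derivative ?L) (at w within ?B)"
        by (auto intro!: derivative_eq_intros)
      then show "((\<lambda>x. F x - ?L x) has_derivative (\<lambda>v. dz F w * v + dzbar F w * cnj v - ?L v)) (at w within ?B)"
        using has_derivative_at_withinI[OF has_derivative_Wirtinger[OF smooth_on_differentiable[OF F near'(3)[OF w]]]]
        by (rule has_derivative_diff[rotated])
      show "onorm (\<lambda>v. dz F w * v + dzbar F w * cnj v - ?L v) \<le> m / 2"
      proof (rule onorm_le)
        fix v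
        have "dz F w * v + dzbar F w * cnj v - ?L v = (dz F w - dz F p) * v + (dzbar F w - dzbar F p) * cnj v"
          by (simp add: algebra_simps)
        then have "cmod (dz F w * v + dzbar F w * cnj v - ?L v) \<le> cmod ((dz F w - dz F p) * v) + cmod ((dzbar F w - dzbar F p) * cnj v)"
          by (metis norm_triangle_ineq)
        also have "\<dots> = (cmod (dz F w - dz F p) + cmod (dzbar F w - dzbar F p)) * cmod v"
          by (simp add: norm_mult distrib_right)
        also have "\<dots> \<le> m / 2 * cmod v"
          using near'(2)[OF w] by (intro mult_right_mono) auto
        finally show "cmod (dz F w * v + dzbar F w * cnj v - ?L v) \<le> m / 2 * cmod v" .
      qed
    qed
    moreover have "cmod ((F x - ?L x) - (F y - ?L y)) = cmod (?L (x - y))"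
      using xy(3) by (simp add: norm_minus_commute algebra_simps)
    ultimately have "m * cmod (x - y) \<le> m / 2 * cmod (x - y)" using Llow[of "x - y"] by linarith
    then show False using xy(4) less by (simp add: m_def)
  qed
  have cont: "continuous_on ?B F" using smooth_on_continuous[OF F] sub continuous_on_subset by blast
  obtain g where "homeomorphism ?B (F ` ?B) F g"
    using invariance_of_domain_homeomorphism[OF open_ball cont _ inj] by auto
  moreover have "open (F ` ?B)" using invariance_of_domain[OF cont open_ball inj] .
  moreover have "Ck_on 1 ?B F" using smooth_on_subset[OF F sub] by (simp add: smooth_on_def)
  moreover have "cmod (dzbar F x / dz F x) \<le> k \<and> dzbar F x = dzbar F x / dz F x * dz F x" if "x \<in> ?B" for x
  proof -
    have lt: "cmod (dzbar F x) < k * cmod (dz F x)" using near'(1)[OF that] by simp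
    then have "0 < k * cmod (dz F x)" using norm_ge_zero[of "dzbar F x"] by linarith
    then have "dz F x \<noteq> 0" by auto
    then show ?thesis using lt by (simp add: norm_divide divide_le_eq)
  qed
  ultimately have "quasiconformal_homeo ?B F"
    unfolding quasiconformal_homeo_def using k(1)
    by (intro conjI exI[of _ g] exI[of _ "\<lambda>x. dzbar F x / dz F x"] exI[of _ k]) auto
  then show thesis using that[of ?B] r sub by auto
qed

text \<open>
  Here \<open>\<alpha>\<close> and \<open>\<beta>\<close> stand for \<open>dz z\<close> and \<open>dzbar z\<close> at a point; equal moduli mean
  that the differential of \<open>z\<close> is of rank at most one. For such a differential the equation,
  written as \<open>a * cnj \<alpha> - d * cnj \<beta> = c * \<beta> - b * \<alpha>\<close>, gives after taking
  moduli the inequality \<open>\<bar>Q\<bar> \<le> 2 * cmod R\<close>, with \<open>Q\<close> and \<open>R\<close> as in the proof. The discriminant condition is precisely the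
  opposite inequality, because its left side equals \<open>4 * (Q\<^sup>2 - 4 * (cmod R)\<^sup>2) / \<Delta>\<^sup>2\<close>. So
  this is the statement that an elliptic system has no real characteristics.
\<close>
lemma elliptic_imp_Jacobian_nonzero:
  fixes a b c d \<alpha> \<beta> :: complex and A11 A12 A21 A22 \<Delta> :: real
  assumes \<Delta>: "\<Delta> = (cmod (a + c))\<^sup>2 - (cmod (b + d))\<^sup>2" "\<Delta> \<noteq> 0"
    and A: "A11 = 2 * (Im ((a + b) * cnj (c + d)) / \<Delta>)"
      "A12 = ((cmod (a + d))\<^sup>2 - (cmod (b + c))\<^sup>2) / \<Delta>"
      "A21 = ((cmod (a - d))\<^sup>2 - (cmod (b - c))\<^sup>2) / \<Delta>"
      "A22 = 2 * (Im (cnj (a - b) * (c - d)) / \<Delta>)"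
    and elliptic: "4 * A12 * A21 - (A11 + A22)\<^sup>2 > 0"
    and eq: "b * \<alpha> + a * cnj \<alpha> - c * \<beta> - d * cnj \<beta> = 0" and nz: "\<alpha> \<noteq> 0 \<or> \<beta> \<noteq> 0"
  shows "cmod \<alpha> \<noteq> cmod \<beta>"
proof
  assume eqn: "cmod \<alpha> = cmod \<beta>"
  define Q where "Q = (cmod a)\<^sup>2 + (cmod d)\<^sup>2 - (cmod b)\<^sup>2 - (cmod c)\<^sup>2"
  define R where "R = a * cnj d - c * cnj b"
  have A12: "A12 * \<Delta> = Q + 2 * Re R" and A21: "A21 * \<Delta> = Q - 2 * Re R" and A1122: "(A11 + A22) * \<Delta> = 4 * Im R"
  proof -
    have "A12 * \<Delta> = (cmod (a + d))\<^sup>2 - (cmod (b + c))\<^sup>2" "A21 * \<Delta> = (cmod (a - d))\<^sup>2 - (cmod (b - c))\<^sup>2"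
      and A1122: "(A11 + A22) * \<Delta> = 2 * Im ((a + b) * cnj (c + d)) + 2 * Im (cnj (a - b) * (c - d))"
      using \<Delta>(2) unfolding A distrib_right by simp_all
    then show "A12 * \<Delta> = Q + 2 * Re R" "A21 * \<Delta> = Q - 2 * Re R"
      unfolding Q_def R_def cmod_power2 by (simp_all add: power2_eq_square algebra_simps)
    show "(A11 + A22) * \<Delta> = 4 * Im R"
      unfolding A1122 R_def by (simp add: algebra_simps)
  qed
  have "(4 * A12 * A21 - (A11 + A22)\<^sup>2) * \<Delta>\<^sup>2 = 4 * (A12 * \<Delta>) * (A21 * \<Delta>) - ((A11 + A22) * \<Delta>)\<^sup>2"
    by (simp add: power2_eq_square algebra_simps)
  also have "\<dots> = 4 * (Q\<^sup>2 - 4 * (cmod R)\<^sup>2)"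
    unfolding A12 A21 A1122 cmod_power2 by (simp add: power2_eq_square algebra_simps)
  finally have "4 * (Q\<^sup>2 - 4 * (cmod R)\<^sup>2) > 0"
    using elliptic \<Delta>(2) by (metis mult_pos_pos zero_less_power2)
  then have QR: "Q\<^sup>2 > (2 * cmod R)\<^sup>2" by (simp add: power_mult_distrib)
  define r where "r = (cmod \<alpha>)\<^sup>2"
  have r: "r > 0" using nz eqn by (auto simp: r_def)
  have "a * cnj \<alpha> - d * cnj \<beta> = c * \<beta> - b * \<alpha>" using eq by (simp add: algebra_simps)
  then have "(cmod (a * cnj \<alpha> - d * cnj \<beta>))\<^sup>2 = (cmod (c * \<beta> - b * \<alpha>))\<^sup>2" by simp
  moreover have "(cmod (a * cnj \<alpha> - d * cnj \<beta>))\<^sup>2 - (cmod (c * \<beta> - b * \<alpha>))\<^sup>2 =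
     ((cmod a)\<^sup>2 - (cmod b)\<^sup>2) * (cmod \<alpha>)\<^sup>2 + ((cmod d)\<^sup>2 - (cmod c)\<^sup>2) * (cmod \<beta>)\<^sup>2 - 2 * Re (cnj \<alpha> * \<beta> * R)"
    unfolding R_def cmod_power2 by (simp add: power2_eq_square algebra_simps)
  ultimately have Qr: "Q * r = 2 * Re (cnj \<alpha> * \<beta> * R)"
    unfolding Q_def r_def eqn[symmetric] by (simp add: algebra_simps)
  have "\<bar>Q\<bar> * r \<le> 2 * cmod (cnj \<alpha> * \<beta> * R)"
  proof -
    have "\<bar>Q\<bar> * r = \<bar>Q * r\<bar>" using r by (simp add: abs_mult)
    then show ?thesis using Qr abs_Re_le_cmod[of "cnj \<alpha> * \<beta> * R"] by linarith
  qed
  also have "\<dots> = 2 * cmod R * r" unfolding norm_mult complex_mod_cnj r_def eqn[symmetric] by (simp add: power2_eq_square)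
  finally have "\<bar>Q\<bar> \<le> 2 * cmod R" using r by simp
  then have "Q\<^sup>2 \<le> (2 * cmod R)\<^sup>2" by (metis abs_ge_zero power2_abs power_mono)
  then show False using QR by simp
qed

section \<open>Local representations\<close>

definition represented_near :: "complex set \<Rightarrow> (complex \<Rightarrow> complex) \<Rightarrow> complex \<Rightarrow> bool" where
  "represented_near D z p \<longleftrightarrow> (\<exists>U. open U \<and> p \<in> U \<and> U \<subseteq> D \<and>
    (\<exists>chi f \<kappa> s Z :: complex \<Rightarrow> complex.
       quasiconformal_homeo U chi \<and>
       f analytic_on (chi ` U) \<and>
       continuous_on (chi ` U) \<kappa> \<and> (\<forall>w\<in>chi ` U. cmod (\<kappa> w) \<noteq> 1) \<and>
       continuous_on (chi ` U) s \<and>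
       (\<forall>w\<in>chi ` U. Z w = (exp (s w) * f w + \<kappa> w * cnj (f w * exp (s w)))
                            / complex_of_real (1 - (cmod (\<kappa> w))\<^sup>2)) \<and>
       (\<forall>\<zeta>\<in>U. z \<zeta> = Z (chi \<zeta>))))"

lemma solve_conjugate_linear:
  assumes "cmod \<kappa> \<noteq> 1" "F = w - \<kappa> * cnj w"
  shows "w = (F + \<kappa> * cnj F) / complex_of_real (1 - (cmod \<kappa>)\<^sup>2)"
proof -
  have "F + \<kappa> * cnj F = w * (1 - \<kappa> * cnj \<kappa>)" unfolding assms(2) by (simp add: algebra_simps)
  also have "1 - \<kappa> * cnj \<kappa> = complex_of_real (1 - (cmod \<kappa>)\<^sup>2)"
    by (simp only: complex_norm_square[symmetric] of_real_diff of_real_1)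
  finally have "F + \<kappa> * cnj F = w * complex_of_real (1 - (cmod \<kappa>)\<^sup>2)" .
  moreover have "complex_of_real (1 - (cmod \<kappa>)\<^sup>2) \<noteq> 0"
    using assms(1) power2_eq_1_iff[of "cmod \<kappa>"] norm_ge_zero[of \<kappa>] by (auto simp del: of_real_diff)
  ultimately show ?thesis by simp
qed

text \<open>
  For a constant \<open>\<kappa>\<close> the formula for \<open>Z\<close> inverts the map that sends \<open>w\<close> to
  \<open>w - \<kappa> * cnj w\<close>, so only the factorization of \<open>z - \<kappa> * cnj z\<close> has to be found.
\<close>
lemma represented_nearI:
  assumes "open U" "p \<in> U" "U \<subseteq> D" "quasiconformal_homeo U chi" "f analytic_on chi ` U"
    "continuous_on (chi ` U) s" "cmod \<kappa> \<noteq> 1"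
    and F: "\<And>\<zeta>. \<zeta> \<in> U \<Longrightarrow> z \<zeta> - \<kappa> * cnj (z \<zeta>) = exp (s (chi \<zeta>)) * f (chi \<zeta>)"
  shows "represented_near D z p"
  unfolding represented_near_def
proof (rule exI[of _ U], intro conjI assms(1-3), rule exI[of _ chi], rule exI[of _ f],
    rule exI[of _ "\<lambda>_. \<kappa>"], rule exI[of _ s],
    rule exI[of _ "\<lambda>w. (exp (s w) * f w + \<kappa> * cnj (f w * exp (s w))) / complex_of_real (1 - (cmod \<kappa>)\<^sup>2)"],
    intro conjI ballI)
  fix \<zeta> assume "\<zeta> \<in> U"
  from solve_conjugate_linear[OF assms(7) F[OF this, symmetric]]
  show "z \<zeta> = (exp (s (chi \<zeta>)) * f (chi \<zeta>) + \<kappa> * cnj (f (chi \<zeta>) * exp (s (chi \<zeta>)))) / complex_of_real (1 - (cmod \<kappa>)\<^sup>2)"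
    by (simp only: mult.commute[of "f (chi \<zeta>)"])
qed (use assms in auto)

lemma represented_near_nonzero:
  assumes D: "open D" "p \<in> D" and z: "continuous_on D z" "z p \<noteq> 0"
  shows "represented_near D z p"
proof -
  have "open (D \<inter> z -` (- {0}))" by (intro continuous_open_preimage[OF z(1) D(1)]) auto
  moreover have "p \<in> D \<inter> z -` (- {0})" using D z by simp
  ultimately obtain r where r: "r > 0" "ball p r \<subseteq> D \<inter> z -` (- {0})"
    using open_contains_ball by blast
  then have "continuous_on (ball p r) z" "\<And>x. x \<in> ball p r \<Longrightarrow> z x \<noteq> 0"
    using continuous_on_subset[OF z(1)] by auto
  then obtain h where "continuous_on (ball p r) h" "\<And>x. x \<in> ball p r \<Longrightarrow> z x = exp (h x)"
    using continuous_logarithm_on_ball by metis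
  then show ?thesis
    using r by (intro represented_nearI[where U = "ball p r" and chi = "\<lambda>x. x" and f = "\<lambda>_. 1" and s = h and \<kappa> = 0])
      (auto intro: quasiconformal_homeo_ident)
qed

text \<open>
  Near a regular point the function \<open>F = z - \<kappa> * cnj z\<close> is itself a quasiconformal
  coordinate, once \<open>\<kappa>\<close> is chosen such that \<open>F\<close> preserves the orientation. The Jacobian of
  \<open>F\<close> is \<open>1 - (cmod \<kappa>)\<^sup>2\<close> times that of \<open>z\<close>, so \<open>\<kappa> = 0\<close> serves for a positive
  and \<open>\<kappa> = 2\<close> for a negative Jacobian.
\<close>
lemma represented_near_regular:
  assumes D: "open D" "p \<in> D" and z: "smooth_on D z" and J: "cmod (dz z p) \<noteq> cmod (dzbar z p)"
  shows "represented_near D z p"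
proof -
  define \<kappa> :: complex where "\<kappa> = (if cmod (dzbar z p) < cmod (dz z p) then 0 else 2)"
  define F where "F = (\<lambda>\<zeta>. z \<zeta> - \<kappa> * cnj (z \<zeta>))"
  have smF: "smooth_on D F" unfolding F_def by (intro smooth_on_intros D z)
  have diff: "z differentiable (at p)" using smooth_on_differentiable[OF z D(2)] .
  note dF = Wirtinger_minus_cnj[OF diff, of \<kappa>, folded F_def]
  have "cmod (dzbar F p) < cmod (dz F p)"
  proof (cases "cmod (dzbar z p) < cmod (dz z p)")
    case True
    then show ?thesis unfolding dF by (simp add: \<kappa>_def)
  next
    case False
    define \<alpha> \<beta> where "\<alpha> = dz z p" and "\<beta> = dzbar z p"
    have lt: "cmod \<alpha> < cmod \<beta>" using False J unfolding \<alpha>_def \<beta>_def by linarith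
    have "(cmod (\<alpha> - 2 * cnj \<beta>))\<^sup>2 - (cmod (\<beta> - 2 * cnj \<alpha>))\<^sup>2 = 3 * ((cmod \<beta>)\<^sup>2 - (cmod \<alpha>)\<^sup>2)"
      unfolding cmod_power2 by (simp add: power2_eq_square algebra_simps)
    moreover have "(cmod \<alpha>)\<^sup>2 < (cmod \<beta>)\<^sup>2" using lt by (intro power_strict_mono) auto
    ultimately have "0 < (cmod (\<alpha> - 2 * cnj \<beta>))\<^sup>2 - (cmod (\<beta> - 2 * cnj \<alpha>))\<^sup>2" by simp
    then have "(cmod (\<beta> - 2 * cnj \<alpha>))\<^sup>2 < (cmod (\<alpha> - 2 * cnj \<beta>))\<^sup>2" by simp
    then have "cmod (\<beta> - 2 * cnj \<alpha>) < cmod (\<alpha> - 2 * cnj \<beta>)" using power2_less_imp_less norm_ge_zero by blast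
    then show ?thesis unfolding dF using False by (simp add: \<kappa>_def \<alpha>_def \<beta>_def)
  qed
  from local_quasiconformal_homeo[OF D smF this]
  obtain U where "open U" "p \<in> U" "U \<subseteq> D" "quasiconformal_homeo U F" .
  then show ?thesis
    by (intro represented_nearI[where U = U and chi = F and f = "\<lambda>w. w" and s = "\<lambda>_. 0" and \<kappa> = \<kappa>])
       (auto simp: F_def \<kappa>_def)
qed

text \<open>
  If \<open>F = z - \<kappa> * cnj z\<close> has leading term \<open>A * (\<zeta> - p) ^ n\<close>, then the quotient
  \<open>G\<close> of \<open>F\<close> by \<open>(\<zeta> - p) ^ n\<close> extends continuously by the nonzero value \<open>A\<close> to
  \<open>p\<close> and has a continuous logarithm, which is \<open>s\<close>.
\<close>
lemma represented_near_monomial: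
  assumes D: "open D" "p \<in> D" and F: "continuous_on D (\<lambda>\<zeta>. z \<zeta> - \<kappa> * cnj (z \<zeta>))" and \<kappa>: "cmod \<kappa> \<noteq> 1" and A: "A \<noteq> 0"
    and r: "0 < r" and le: "\<And>\<zeta>. \<zeta> \<in> ball p r \<Longrightarrow>
      cmod (z \<zeta> - \<kappa> * cnj (z \<zeta>) - A * (\<zeta> - p) ^ n) \<le> C * cmod (\<zeta> - p) ^ Suc n" and n: "n > 0"
  shows "represented_near D z p"
proof -
  define F where "F = (\<lambda>\<zeta>. z \<zeta> - \<kappa> * cnj (z \<zeta>))"
  define G where "G = (\<lambda>\<zeta>. if \<zeta> = p then A else F \<zeta> / (\<zeta> - p) ^ n)"
  have Fp: "F p = 0" using le[of p] r n by (simp add: F_def)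
  have G: "F \<zeta> = G \<zeta> * (\<zeta> - p) ^ n" for \<zeta> using Fp n by (simp add: G_def)
  have Gle: "cmod (G \<zeta> - A) \<le> \<bar>C\<bar> * cmod (\<zeta> - p)" if "\<zeta> \<in> ball p r" for \<zeta>
  proof (cases "\<zeta> = p")
    case False
    have "cmod (G \<zeta> - A) = cmod (F \<zeta> - A * (\<zeta> - p) ^ n) / cmod (\<zeta> - p) ^ n"
      using False by (simp add: G_def divide_diff_eq_iff norm_divide norm_power)
    also have "\<dots> \<le> C * cmod (\<zeta> - p) ^ Suc n / cmod (\<zeta> - p) ^ n"
      using le[OF that] by (intro divide_right_mono) (auto simp: F_def)
    also have "\<dots> = C * cmod (\<zeta> - p)" using False by simp
    also have "\<dots> \<le> \<bar>C\<bar> * cmod (\<zeta> - p)" by (intro mult_right_mono) auto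
    finally show ?thesis .
  qed (simp add: G_def)
  have lim: "(G \<longlongrightarrow> A) (at p)"
  proof -
    have "((\<lambda>\<zeta>. \<bar>C\<bar> * cmod (\<zeta> - p)) \<longlongrightarrow> \<bar>C\<bar> * cmod (p - p)) (at p)" by (intro tendsto_intros)
    then have to0: "((\<lambda>\<zeta>. \<bar>C\<bar> * cmod (\<zeta> - p)) \<longlongrightarrow> 0) (at p)" by simp
    have "\<forall>\<^sub>F \<zeta> in at p. \<zeta> \<in> ball p r" using r by (intro eventually_at_in_open') auto
    then have "\<forall>\<^sub>F \<zeta> in at p. norm (G \<zeta> - A) \<le> \<bar>C\<bar> * cmod (\<zeta> - p)" by eventually_elim (rule Gle)
    from Lim_null_comparison[OF this to0] have "((\<lambda>\<zeta>. G \<zeta> - A) \<longlongrightarrow> 0) (at p)" .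
    then show ?thesis by (simp add: LIM_zero_cancel)
  qed
  have contG: "continuous_on D G"
  proof (rule continuous_at_imp_continuous_on, rule ballI)
    fix \<zeta> assume \<zeta>: "\<zeta> \<in> D"
    show "isCont G \<zeta>"
    proof (cases "\<zeta> = p")
      case True
      then show ?thesis using lim by (simp add: isCont_def G_def)
    next
      case False
      have "open (D - {p})" using D by auto
      moreover have "continuous_on (D - {p}) (\<lambda>\<zeta>. F \<zeta> / (\<zeta> - p) ^ n)"
        unfolding F_def by (intro continuous_on_divide continuous_on_subset[OF F] continuous_intros) auto
      then have "continuous_on (D - {p}) G" by (rule continuous_on_eq) (simp add: G_def)
      ultimately show ?thesis using \<zeta> False by (simp add: continuous_on_eq_continuous_at)
    qed
  qed
  have "open (D \<inter> G -` (- {0}))" by (intro continuous_open_preimage[OF contG D(1)]) auto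
  moreover have "p \<in> D \<inter> G -` (- {0})" using D A by (simp add: G_def)
  ultimately obtain r where r: "r > 0" "ball p r \<subseteq> D \<inter> G -` (- {0})"
    using open_contains_ball by blast
  then have "continuous_on (ball p r) G" "\<And>x. x \<in> ball p r \<Longrightarrow> G x \<noteq> 0"
    using continuous_on_subset[OF contG] by auto
  then obtain h where "continuous_on (ball p r) h" "\<And>x. x \<in> ball p r \<Longrightarrow> G x = exp (h x)"
    using continuous_logarithm_on_ball by metis
  then show ?thesis
    using r \<kappa> G by (intro represented_nearI[where U = "ball p r" and chi = "\<lambda>x. x" and f = "\<lambda>w. (w - p) ^ n" and s = h and \<kappa> = \<kappa>])
      (auto intro!: quasiconformal_homeo_ident analytic_intros simp: F_def)
qed


lemma exists_exact_vanishing_order: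
  assumes "f p = 0" "\<not> (\<forall>n. vanishes_to_order n p f)"
  obtains n where "n > 0" "vanishes_to_order n p f" "\<not> vanishes_to_order (Suc n) p f"
proof -
  obtain m where m: "\<not> vanishes_to_order m p f" using assms(2) by blast
  have "vanishes_to_order 0 p f" by simp
  from ex_least_nat_less[of "\<lambda>n. \<not> vanishes_to_order n p f" m] m
  obtain n where n: "vanishes_to_order n p f" "\<not> vanishes_to_order (Suc n) p f" by auto
  moreover have "n > 0" using n(2) assms(1) by (cases n) auto
  ultimately show thesis using that by blast
qed

text \<open>
  At a critical zero \<open>p\<close> of \<open>z\<close> the equation with coefficients frozen at \<open>p\<close> reads
  \<open>cnj (dz z) = c p * dzbar z\<close>, which for \<open>\<kappa> = 1 / c p\<close> says that
  \<open>F = z - \<kappa> * cnj z\<close> is holomorphic. The remaining terms of \<open>dzbar F\<close> are products of first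
  derivatives of \<open>z\<close> with functions that vanish at \<open>p\<close>. If \<open>F\<close> vanishes to finite order
  \<open>n\<close>, then so does \<open>z\<close>, and \<open>dzbar F\<close> also vanishes to order \<open>n\<close> instead of
  \<open>n - 1\<close>; hence the leading term of \<open>F\<close> is a multiple of \<open>(\<zeta> - p) ^ n\<close>.

  If the order is infinite, \<open>u = cnj z\<close> is flat at \<open>p\<close>. Since \<open>cmod (c p) < 1\<close>, the
  equation also shows that \<open>u\<close> is quasiregular near \<open>p\<close>, and unique continuation yields
  \<open>z = 0\<close> near \<open>p\<close>, which is represented with \<open>f = 0\<close>.
\<close>
lemma represented_near_critical_zero:
  fixes z a b c d :: "complex \<Rightarrow> complex"
  assumes D: "open D" "p \<in> D" and z: "smooth_on D z"
    and coeff: "smooth_on D a" "smooth_on D b" "smooth_on D c" "smooth_on D d"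
    and at_p: "a p = 1" "b p = 0" "d p = 0" "cmod (c p) < 1" "c p \<noteq> 0"
    and eq: "\<And>\<zeta>. \<zeta> \<in> D \<Longrightarrow> b \<zeta> * dz z \<zeta> + a \<zeta> * cnj (dz z \<zeta>) - c \<zeta> * dzbar z \<zeta> - d \<zeta> * cnj (dzbar z \<zeta>) = 0"
    and z0: "z p = 0"
  shows "represented_near D z p"
proof -
  define \<kappa> where "\<kappa> = 1 / c p"
  have \<kappa>: "cmod \<kappa> > 1" "\<kappa> * c p = 1" using at_p by (simp_all add: \<kappa>_def norm_divide)
  define F where "F = (\<lambda>\<zeta>. z \<zeta> - \<kappa> * cnj (z \<zeta>))"
  have smF: "smooth_on D F" unfolding F_def by (intro smooth_on_intros D z)
  have Fp: "F p = 0" using z0 by (simp add: F_def)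
  note sm = z smooth_on_dz[OF D(1) z] smooth_on_dzbar[OF D(1) z] coeff D
  have z_order: "vanishes_to_order n p z" if F: "vanishes_to_order n p F" for n
  proof -
    let ?e = "1 / complex_of_real (1 - (cmod \<kappa>)\<^sup>2)"
    have "z = (\<lambda>\<zeta>. ?e * (F \<zeta> + \<kappa> * cnj (F \<zeta>)))"
      using solve_conjugate_linear[of \<kappa> "F \<zeta>" "z \<zeta>" for \<zeta>] \<kappa>(1) by (auto simp: F_def)
    moreover have "vanishes_to_order n p (\<lambda>\<zeta>. ?e * (F \<zeta> + \<kappa> * cnj (F \<zeta>)))"
      by (intro vanishes_to_order_mult_smooth[OF D] vanishes_to_order_add[OF D] vanishes_to_order_cnj[OF D]
          smooth_on_const smooth_on_mult smooth_on_add smooth_on_cnj F smF D)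
    ultimately show ?thesis by metis
  qed
  have dF: "dzbar F \<zeta> = \<kappa> * ((a \<zeta> - a p) * cnj (dz z \<zeta>) + b \<zeta> * dz z \<zeta> + ((c p - c \<zeta>) * dzbar z \<zeta> + (- d \<zeta>) * cnj (dzbar z \<zeta>)))"
    if \<zeta>: "\<zeta> \<in> D" for \<zeta>
  proof -
    have diff: "z differentiable (at \<zeta>)" using smooth_on_differentiable[OF z \<zeta>] .
    have "dzbar F \<zeta> = dzbar z \<zeta> - \<kappa> * cnj (dz z \<zeta>)"
      unfolding F_def by (rule Wirtinger_minus_cnj[OF diff])
    also have "\<dots> = \<kappa> * (c p * dzbar z \<zeta> - cnj (dz z \<zeta>))"
      using \<kappa>(2) by (simp add: right_diff_distrib mult.assoc[symmetric])
    also have "c p * dzbar z \<zeta> - cnj (dz z \<zeta>) =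
        (a \<zeta> - a p) * cnj (dz z \<zeta>) + b \<zeta> * dz z \<zeta> + ((c p - c \<zeta>) * dzbar z \<zeta> + (- d \<zeta>) * cnj (dzbar z \<zeta>))
        - (b \<zeta> * dz z \<zeta> + a \<zeta> * cnj (dz z \<zeta>) - c \<zeta> * dzbar z \<zeta> - d \<zeta> * cnj (dzbar z \<zeta>))"
      using at_p(1) by (simp add: algebra_simps)
    also have "\<dots> = (a \<zeta> - a p) * cnj (dz z \<zeta>) + b \<zeta> * dz z \<zeta> + ((c p - c \<zeta>) * dzbar z \<zeta> + (- d \<zeta>) * cnj (dzbar z \<zeta>))"
      unfolding eq[OF \<zeta>] by simp
    finally show ?thesis .
  qed
  show ?thesis
  proof (cases "\<forall>n. vanishes_to_order n p F")
    case False
    obtain n where n: "n > 0" "vanishes_to_order n p F" "\<not> vanishes_to_order (Suc n) p F"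
      using exists_exact_vanishing_order[OF Fp False] .
    obtain m where m: "n = Suc m" using n(1) gr0_conv_Suc by blast
    have dz_order: "vanishes_to_order m p (dz z)" "vanishes_to_order m p (dzbar z)"
      using z_order[OF n(2)] by (simp_all add: m)
    let ?W = "\<lambda>\<zeta>. \<kappa> * ((a \<zeta> - a p) * cnj (dz z \<zeta>) + b \<zeta> * dz z \<zeta> + ((c p - c \<zeta>) * dzbar z \<zeta> + (- d \<zeta>) * cnj (dzbar z \<zeta>)))"
    have "vanishes_to_order n p ?W"
      unfolding m
      by (intro vanishes_to_order_mult_smooth[OF D] vanishes_to_order_add[OF D] vanishes_to_order_Suc_mult[OF D]
          vanishes_to_order_cnj[OF D] dz_order smooth_on_const smooth_on_mult smooth_on_add smooth_on_diff
          smooth_on_minus smooth_on_cnj sm) (simp_all add: at_p)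
    then have "vanishes_to_order n p (dzbar F)"
      using vanishes_to_order_cong[OF D, of "dzbar F" ?W n] dF by blast
    then obtain A where A: "vanishes_to_order (Suc n) p (\<lambda>\<zeta>. F \<zeta> - A * (\<zeta> - p) ^ n)"
      using leading_monomial[OF D smF n(2)] by blast
    have "A \<noteq> 0" using A n(3) by auto
    have "smooth_on D (\<lambda>\<zeta>. F \<zeta> - A * (\<zeta> - p) ^ n)"
      by (intro smooth_on_diff smooth_on_mult smooth_on_power smooth_on_const smooth_on_ident smF D)
    from vanishes_to_order_bound[OF D this A]
    obtain C r where "0 < r" "\<And>\<zeta>. \<zeta> \<in> ball p r \<Longrightarrow> cmod (F \<zeta> - A * (\<zeta> - p) ^ n) \<le> C * cmod (\<zeta> - p) ^ Suc n"
      by blast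
    then show ?thesis
      using \<kappa>(1) \<open>A \<noteq> 0\<close> n(1) smooth_on_continuous[OF smF] D
      by (intro represented_near_monomial[where \<kappa> = \<kappa> and A = A and n = n and C = C and r = r]) (auto simp: F_def)
  next
    case True
    define k where "k = (1 + cmod (c p)) / 2"
    have k: "0 \<le> k" "k < 1" "cmod (c p) < k" using at_p(4) by (auto simp: k_def)
    have cont: "isCont a p" "isCont b p" "isCont c p" "isCont d p" "isCont z p"
      using smooth_on_continuous[OF coeff(1)] smooth_on_continuous[OF coeff(2)] smooth_on_continuous[OF coeff(3)]
        smooth_on_continuous[OF coeff(4)] smooth_on_continuous[OF z] D
      by (auto simp: continuous_on_eq_continuous_at)
    have "\<forall>\<^sub>F x in at p. cmod (c x) + cmod (d x) - k * (cmod (a x) - cmod (b x)) < 0"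
    proof (rule order_tendstoD(2))
      show "((\<lambda>x. cmod (c x) + cmod (d x) - k * (cmod (a x) - cmod (b x))) \<longlongrightarrow>
          cmod (c p) + cmod (d p) - k * (cmod (a p) - cmod (b p))) (at p)"
        using cont unfolding isCont_def by (intro tendsto_intros)
    qed (use k at_p in simp)
    moreover have "\<forall>\<^sub>F x in at p. cmod (a x) - cmod (b x) > 0"
    proof (rule order_tendstoD(1))
      show "((\<lambda>x. cmod (a x) - cmod (b x)) \<longlongrightarrow> cmod (a p) - cmod (b p)) (at p)"
        using cont unfolding isCont_def by (intro tendsto_intros)
    qed (use at_p in simp)
    moreover have "\<forall>\<^sub>F x in at p. cmod (z x) < 1/4"
    proof (rule order_tendstoD(2))
      show "((\<lambda>x. cmod (z x)) \<longlongrightarrow> cmod (z p)) (at p)"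
        using cont unfolding isCont_def by (intro tendsto_intros)
    qed (use z0 in simp)
    ultimately have "\<forall>\<^sub>F x in at p. cmod (c x) + cmod (d x) - k * (cmod (a x) - cmod (b x)) < 0 \<and>
        cmod (a x) - cmod (b x) > 0 \<and> cmod (z x) < 1/4" by eventually_elim blast
    then obtain r1 where r1: "r1 > 0" and near: "\<And>x. x \<noteq> p \<Longrightarrow> dist x p < r1 \<Longrightarrow>
        cmod (c x) + cmod (d x) - k * (cmod (a x) - cmod (b x)) < 0 \<and> cmod (a x) - cmod (b x) > 0 \<and> cmod (z x) < 1/4"
      unfolding eventually_at by blast
    have near': "cmod (c x) + cmod (d x) \<le> k * (cmod (a x) - cmod (b x)) \<and> cmod (a x) - cmod (b x) > 0 \<and> cmod (z x) \<le> 1/4"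
      if "x \<in> ball p r1" for x
      using near[of x] that k at_p z0 by (cases "x = p") (auto simp: dist_commute)
    obtain r2 where r2: "r2 > 0" "cball p r2 \<subseteq> D" using D open_contains_cball by blast
    define R where "R = min r1 r2"
    have R: "R > 0" "cball p R \<subseteq> D" "ball p R \<subseteq> D" using r1 r2 by (auto simp: R_def)
    define u where "u = (\<lambda>\<zeta>. cnj (z \<zeta>))"
    have smu: "smooth_on D u" unfolding u_def by (intro smooth_on_cnj D z)
    have zero: "u x = 0" if "x \<in> ball p R" for x
    proof (rule quasiregular_flat_imp_zero[OF D(1) R(2,1) smu _ k(1,2) _ _ that])
      fix x assume x: "x \<in> ball p R"
      then have xr: "x \<in> ball p r1" and xD: "x \<in> D" using R by (auto simp: R_def)
      note nr = near'[OF xr]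
      show "cmod (u x) \<le> 1/4" using nr by (simp add: u_def)
      have diff: "z differentiable (at x)" using smooth_on_differentiable[OF z xD] .
      have "a x * cnj (dz z x) = c x * dzbar z x + d x * cnj (dzbar z x) - b x * dz z x"
        using eq[OF xD] by (simp add: algebra_simps)
      then have "cmod (a x * cnj (dz z x)) \<le> cmod (c x * dzbar z x) + cmod (d x * cnj (dzbar z x)) + cmod (b x * dz z x)"
        by (metis norm_triangle_ineq4 norm_triangle_ineq add_right_mono order_trans)
      then have "(cmod (a x) - cmod (b x)) * cmod (dz z x) \<le> (cmod (c x) + cmod (d x)) * cmod (dzbar z x)"
        by (simp add: norm_mult algebra_simps)
      also have "\<dots> \<le> k * (cmod (a x) - cmod (b x)) * cmod (dzbar z x)"
        using nr by (intro mult_right_mono) auto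
      finally have "(cmod (a x) - cmod (b x)) * cmod (dz z x) \<le> (cmod (a x) - cmod (b x)) * (k * cmod (dzbar z x))"
        by (simp add: mult_ac)
      then have "cmod (dz z x) \<le> k * cmod (dzbar z x)" using nr by (simp only: mult_le_cancel_left_pos)
      then show "cmod (dzbar u x) \<le> k * cmod (dz u x)"
        unfolding u_def Wirtinger_cnj[OF diff] by simp
    next
      fix N :: nat
      have "vanishes_to_order N p u" unfolding u_def
        by (intro vanishes_to_order_cnj[OF D z] z_order) (use True in blast)
      from vanishes_to_order_bound[OF D smu this]
      show "\<exists>C r. 0 < r \<and> (\<forall>x\<in>ball p r. cmod (u x) \<le> C * cmod (x - p) ^ N)" by blast
    qed
    then have "z x = 0" if "x \<in> ball p R" for x using that by (simp add: u_def)
    then show ?thesis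
      using R by (intro represented_nearI[where U = "ball p R" and chi = "\<lambda>x. x" and f = "\<lambda>_. 0" and s = "\<lambda>_. 0" and \<kappa> = 0])
        (auto intro: quasiconformal_homeo_ident)
  qed
qed

section \<open>The representation theorem\<close>

theorem theorem3p5:
  fixes n :: "complex \<Rightarrow> real" and \<Omega> D :: "complex set" and z :: "complex \<Rightarrow> complex"
    and l :: "complex \<Rightarrow> complex"
    and a b c d :: "complex \<Rightarrow> complex" and A11 A12 A21 A22 :: "complex \<Rightarrow> real"
  assumes "open \<Omega>" and "smooth_on \<Omega> n" and "\<And>w. w \<in> \<Omega> \<Longrightarrow> n w > 0"
    and "open D" and "D \<subseteq> - {0}"
    and "smooth_on D z" and "z ` D \<subseteq> \<Omega>"
    and "\<And>\<zeta>. \<zeta> \<in> D \<Longrightarrow> l \<zeta> = complex_of_real (ln (n (z \<zeta>)))"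
    and "\<And>\<zeta>. \<zeta> \<in> D \<Longrightarrow> a \<zeta> = 1 + \<zeta> * dz l \<zeta>"
    and "\<And>\<zeta>. \<zeta> \<in> D \<Longrightarrow> b \<zeta> = - (1 / \<zeta>) * dzbar l \<zeta>"
    and "\<And>\<zeta>. \<zeta> \<in> D \<Longrightarrow> c \<zeta> = (1 / \<zeta>\<^sup>2) * (1 - \<zeta> * dz l \<zeta>)"
    and "\<And>\<zeta>. \<zeta> \<in> D \<Longrightarrow> d \<zeta> = \<zeta> * dzbar l \<zeta>"
    and "\<And>\<zeta>. \<zeta> \<in> D \<Longrightarrow> (cmod (a \<zeta> + c \<zeta>))\<^sup>2 - (cmod (b \<zeta> + d \<zeta>))\<^sup>2 \<noteq> 0"
    and "\<And>\<zeta>. \<zeta> \<in> D \<Longrightarrow> A11 \<zeta> = 2 * (Im ((a \<zeta> + b \<zeta>) * cnj (c \<zeta> + d \<zeta>))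
           / ((cmod (a \<zeta> + c \<zeta>))\<^sup>2 - (cmod (b \<zeta> + d \<zeta>))\<^sup>2))"
    and "\<And>\<zeta>. \<zeta> \<in> D \<Longrightarrow> A12 \<zeta> = ((cmod (a \<zeta> + d \<zeta>))\<^sup>2 - (cmod (b \<zeta> + c \<zeta>))\<^sup>2)
           / ((cmod (a \<zeta> + c \<zeta>))\<^sup>2 - (cmod (b \<zeta> + d \<zeta>))\<^sup>2)"
    and "\<And>\<zeta>. \<zeta> \<in> D \<Longrightarrow> A21 \<zeta> = ((cmod (a \<zeta> - d \<zeta>))\<^sup>2 - (cmod (b \<zeta> - c \<zeta>))\<^sup>2)
           / ((cmod (a \<zeta> + c \<zeta>))\<^sup>2 - (cmod (b \<zeta> + d \<zeta>))\<^sup>2)"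
    and "\<And>\<zeta>. \<zeta> \<in> D \<Longrightarrow> A22 \<zeta> = 2 * (Im (cnj (a \<zeta> - b \<zeta>) * (c \<zeta> - d \<zeta>))
           / ((cmod (a \<zeta> + c \<zeta>))\<^sup>2 - (cmod (b \<zeta> + d \<zeta>))\<^sup>2))"
    and "\<And>\<zeta>. \<zeta> \<in> D \<Longrightarrow> 4 * A12 \<zeta> * A21 \<zeta> - (A11 \<zeta> + A22 \<zeta>)\<^sup>2 > 0"
    and "\<And>\<zeta>. \<zeta> \<in> D \<Longrightarrow> A12 \<zeta> > 0"
    and "\<And>\<zeta>. \<zeta> \<in> D \<Longrightarrow> b \<zeta> * dz z \<zeta> + a \<zeta> * dzbar (\<lambda>w. cnj (z w)) \<zeta>
           - c \<zeta> * dzbar z \<zeta> - d \<zeta> * dz (\<lambda>w. cnj (z w)) \<zeta> = 0"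
  shows "\<forall>p\<in>D. \<exists>U. open U \<and> p \<in> U \<and> U \<subseteq> D \<and>
    (\<exists>chi f \<kappa> s Z :: complex \<Rightarrow> complex.
       quasiconformal_homeo U chi \<and>
       f analytic_on (chi ` U) \<and>
       continuous_on (chi ` U) \<kappa> \<and> (\<forall>w\<in>chi ` U. cmod (\<kappa> w) \<noteq> 1) \<and>
       continuous_on (chi ` U) s \<and>
       (\<forall>w\<in>chi ` U. Z w = (exp (s w) * f w + \<kappa> w * cnj (f w * exp (s w)))
                            / complex_of_real (1 - (cmod (\<kappa> w))\<^sup>2)) \<and>
       (\<forall>\<zeta>\<in>U. z \<zeta> = Z (chi \<zeta>)))"
proof
  fix p assume p: "p \<in> D"
  note n = assms(2,3) and openD = assms(4) and D0 = assms(5) and z = assms(6) and zOmega = assms(7)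
    and l = assms(8) and A12_pos = assms(19)
  note coeff_def = assms(9-12)
  have p0: "p \<noteq> 0" using D0 p by auto
  have differ: "z differentiable (at \<zeta>)" if "\<zeta> \<in> D" for \<zeta> using smooth_on_differentiable[OF z that] .
  have eq: "b \<zeta> * dz z \<zeta> + a \<zeta> * cnj (dz z \<zeta>) - c \<zeta> * dzbar z \<zeta> - d \<zeta> * cnj (dzbar z \<zeta>) = 0"
    if "\<zeta> \<in> D" for \<zeta>
    using assms(20)[OF that] unfolding Wirtinger_cnj[OF differ[OF that]] .
  have "represented_near D z p"
  proof (cases "z p = 0")
    case False
    then show ?thesis by (rule represented_near_nonzero[OF openD p smooth_on_continuous[OF z]])
  next
    case z0: True
    show ?thesis
    proof (cases "dz z p = 0 \<and> dzbar z p = 0")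
      case False
      have "cmod (dz z p) \<noteq> cmod (dzbar z p)"
        by (rule elliptic_imp_Jacobian_nonzero[OF refl assms(13)[OF p] assms(14-17)[OF p] assms(18)[OF p] eq[OF p]])
           (use False in blast)
      then show ?thesis by (rule represented_near_regular[OF openD p z])
    next
      case True
      have smn: "smooth_on D (\<lambda>\<zeta>. n (z \<zeta>))" using smooth_on_compose[OF openD n(1) z zOmega] .
      have "smooth_on D (\<lambda>\<zeta>. complex_of_real (ln (n (z \<zeta>))))"
        using smn n(2) zOmega by (intro smooth_on_of_real smooth_on_ln openD) auto
      then have sml: "smooth_on D l"
        using smooth_on_cong[OF openD, of l "\<lambda>\<zeta>. complex_of_real (ln (n (z \<zeta>)))"] l by blast
      note smdl = smooth_on_dz[OF openD sml] smooth_on_dzbar[OF openD sml]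
      have nz: "\<zeta> \<noteq> 0" "\<zeta>\<^sup>2 \<noteq> 0" if "\<zeta> \<in> D" for \<zeta> using D0 that by auto
      have sm: "smooth_on D a" "smooth_on D b" "smooth_on D c" "smooth_on D d"
      proof -
        have "smooth_on D (\<lambda>\<zeta>. 1 + \<zeta> * dz l \<zeta>)" "smooth_on D (\<lambda>\<zeta>. - (1 / \<zeta>) * dzbar l \<zeta>)"
          "smooth_on D (\<lambda>\<zeta>. (1 / \<zeta>\<^sup>2) * (1 - \<zeta> * dz l \<zeta>))" "smooth_on D (\<lambda>\<zeta>. \<zeta> * dzbar l \<zeta>)"
          by (intro smooth_on_add smooth_on_diff smooth_on_mult smooth_on_minus smooth_on_divide smooth_on_power
              smooth_on_const smooth_on_ident smdl openD; use nz in blast)+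
        then show "smooth_on D a" "smooth_on D b" "smooth_on D c" "smooth_on D d"
          using smooth_on_cong[OF openD, of a "\<lambda>\<zeta>. 1 + \<zeta> * dz l \<zeta>"]
            smooth_on_cong[OF openD, of b "\<lambda>\<zeta>. - (1 / \<zeta>) * dzbar l \<zeta>"]
            smooth_on_cong[OF openD, of c "\<lambda>\<zeta>. (1 / \<zeta>\<^sup>2) * (1 - \<zeta> * dz l \<zeta>)"]
            smooth_on_cong[OF openD, of d "\<lambda>\<zeta>. \<zeta> * dzbar l \<zeta>"] coeff_def by blast+
      qed
      \<comment> \<open>at a critical point of \<open>z\<close> also \<open>l\<close> is stationary, which determines the coefficients at \<open>p\<close>\<close>
      have "(z has_derivative (\<lambda>v. 0)) (at p)"
        using has_derivative_Wirtinger[OF differ[OF p]] True by simp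
      moreover have "(n has_derivative frechet_derivative n (at (z p))) (at (z p))"
        using smooth_on_has_derivative[OF n(1)] zOmega p by blast
      ultimately have "((\<lambda>\<zeta>. n (z \<zeta>)) has_derivative (\<lambda>v. frechet_derivative n (at (z p)) 0)) (at p)"
        by (rule has_derivative_compose)
      moreover have "frechet_derivative n (at (z p)) 0 = 0"
        using smooth_on_has_derivative[OF n(1), of "z p"] zOmega p has_derivative_linear linear_0 by blast
      ultimately have "((\<lambda>\<zeta>. n (z \<zeta>)) has_derivative (\<lambda>v. 0)) (at p)" by simp
      moreover have "n (z p) > 0" using n(2) zOmega p by blast
      ultimately have "((\<lambda>\<zeta>. complex_of_real (ln (n (z \<zeta>)))) has_derivative (\<lambda>v. 0)) (at p)"
        using has_derivative_of_real[OF has_derivative_ln[of "\<lambda>\<zeta>. n (z \<zeta>)" p]] by fastforce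
      then have "(l has_derivative (\<lambda>v. 0 * v + 0 * cnj v)) (at p)"
        using has_derivative_transform_within_open[OF _ openD p] l by force
      note dl = Wirtinger_eqI[OF this]
      have at_p: "a p = 1" "b p = 0" "c p = 1 / p\<^sup>2" "d p = 0"
        using coeff_def[OF p] by (simp_all add: dl)
      have "c p \<noteq> 0" using p0 at_p by simp
      moreover have "cmod (c p) < 1"
      proof -
        have "(1 - (cmod (c p))\<^sup>2) / (cmod (1 + c p))\<^sup>2 > 0"
          using A12_pos[OF p] unfolding assms(15)[OF p] by (simp add: at_p)
        then have "(cmod (c p))\<^sup>2 < 1\<^sup>2" by (simp add: zero_less_divide_iff)
        then show ?thesis by (rule power2_less_imp_less) simp
      qed
      ultimately show ?thesis
        using represented_near_critical_zero[OF openD p z sm at_p(1,2,4) _ _ eq z0] by blast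
    qed
  qed
  then show "\<exists>U. open U \<and> p \<in> U \<and> U \<subseteq> D \<and>
    (\<exists>chi f \<kappa> s Z :: complex \<Rightarrow> complex.
       quasiconformal_homeo U chi \<and>
       f analytic_on (chi ` U) \<and>
       continuous_on (chi ` U) \<kappa> \<and> (\<forall>w\<in>chi ` U. cmod (\<kappa> w) \<noteq> 1) \<and>
       continuous_on (chi ` U) s \<and>
       (\<forall>w\<in>chi ` U. Z w = (exp (s w) * f w + \<kappa> w * cnj (f w * exp (s w)))
                            / complex_of_real (1 - (cmod (\<kappa> w))\<^sup>2)) \<and>
       (\<forall>\<zeta>\<in>U. z \<zeta> = Z (chi \<zeta>)))"
    unfolding represented_near_def .
qed

end
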